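(* Let $d$ be a positive integer, let $f=T_d(x,y,z)\in\mathbb{C}[x,y,z]$ be the homogenization (with respect to $z$, to degree $d$) of $T_d(x)+T_d(y)$, where $T_d$ is the Chebyshev polynomial of degree $d$, let $\mathcal{C}_d\subset\mathbb{P}^2$ be the complex projective plane curve $f=0$, and let $M=M(f)=\mathbb{C}[x,y,z]/(f_x,f_y,f_z)$ be the graded Milnor algebra. (i) If $d=2m$ is even, then the curve $\mathcal{C}_d$ has $2m(m-1)$ nodes as singularities and $\dim M_k=2m(m-1)$ for $k\geq 2d-3$. (ii) If $d=2m+1$ is odd, then the curve $\mathcal{C}_d$ has $2m^2$ nodes as singularities and $\dim M_k=2m^2$ for $k\geq 2d-3$.
   Context: The Chebyshev polynomial $T_d(x)$ is the polynomial of degree $d$ determined by $T_d(x)=\cos(d\arccos x)$. A node is an $A_1$-singularity (ordinary double point); "has $n$ nodes as singularities" means that the singular locus consists of exactly $n$ points, all of them nodes. $M_k$ denotes the degree $k$ homogeneous component of $M$. *)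

theory Defs
  imports
    "HOL-Algebra.Algebraic_Closure_Type"
    "HOL-Algebra.Embedded_Algebras"
    "HOL-Library.Poly_Mapping"
    "HOL-Analysis.Analysis"
    "HOL-Computational_Algebra.Polynomial"
begin

section \<open>Chebyshev polynomials\<close>

definition cheb :: "nat \<Rightarrow> real poly" where
  "cheb d = (THE p. degree p = d \<and> (\<forall>x\<in>{-1..1}. poly p x = cos (real d * arccos x)))"

lemma cheb_unique_existence:
  "\<exists>!p. degree p = d \<and> (\<forall>x\<in>{-1..1}. poly p x = cos (real d * arccos x))"
proof -
  have "\<exists>p q :: real poly.
      degree p = d \<and> (\<forall>x\<in>{-1..1}. poly p x = cos (real d * arccos x)) \<and>
      degree q = Suc d \<and> (\<forall>x\<in>{-1..1}. poly q x = cos (real (Suc d) * arccos x))"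
  proof (induction d)
    case 0
    show ?case
      by (rule exI[of _ 1], rule exI[of _ "[:0, 1:]"]) auto
  next
    case (Suc d)
    then obtain p q :: "real poly" where
      p: "degree p = d" "\<And>x. x \<in> {-1..1} \<Longrightarrow> poly p x = cos (real d * arccos x)" and
      q: "degree q = Suc d" "\<And>x. x \<in> {-1..1} \<Longrightarrow> poly q x = cos (real (Suc d) * arccos x)"
      by blast
    define r where "r = [:0, 2:] * q + (- p)"
    have "q \<noteq> 0"
      using q(1) by auto
    then have "degree ([:0, 2:] * q) = Suc (Suc d)"
      using q(1) by (subst degree_mult_eq) auto
    then have "degree r = Suc (Suc d)"
      unfolding r_def by (subst degree_add_eq_left) (use p(1) in auto)
    moreover have "poly r x = cos (real (Suc (Suc d)) * arccos x)" if x: "x \<in> {-1..1}" for x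
    proof -
      define t where "t = arccos x"
      have t: "cos t = x"
        using x by (simp add: t_def)
      have eqs: "real (Suc (Suc d)) * t = real (Suc d) * t + t" "real d * t = real (Suc d) * t - t"
        by (auto simp: algebra_simps)
      have "poly r x = 2 * x * cos (real (Suc d) * t) - cos (real d * t)"
        using p(2)[OF x] q(2)[OF x] by (simp add: r_def t_def)
      also have "\<dots> = cos (real (Suc (Suc d)) * t)"
        unfolding eqs cos_add cos_diff t by (simp add: algebra_simps)
      finally show ?thesis
        by (simp add: t_def)
    qed
    ultimately show ?case
      using q by blast
  qed
  moreover have "p = q"
    if "\<forall>x\<in>{-1..1}. poly p x = cos (real d * arccos x)"
       "\<forall>x\<in>{-1..1}. poly q x = cos (real d * arccos x)" for p q :: "real poly"
  proof (rule ccontr)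
    assume "p \<noteq> q"
    then have "finite {x. poly (p - q) x = 0}"
      by (intro poly_roots_finite) auto
    moreover have "{-1..1} \<subseteq> {x. poly (p - q) x = 0}"
      using that by auto
    ultimately have "finite {-1..(1::real)}"
      by (rule finite_subset[rotated])
    then show False
      using infinite_Icc[of "-1" "1::real"] by simp
  qed
  ultimately show ?thesis
    by blast
qed

section \<open>Polynomials in three variables\<close>

text \<open>The variables x, y, z are indexed by the elements 1, 2, 3 of the three-element type, as
  are the coordinates of vectors in \<open>complex ^ 3\<close>.\<close>

type_synonym poly3 = "(3 \<Rightarrow>\<^sub>0 nat) \<Rightarrow>\<^sub>0 complex"

definition Const :: "complex \<Rightarrow> poly3" where
  "Const c = Poly_Mapping.single 0 c"

definition Var :: "3 \<Rightarrow> poly3" where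
  "Var i = Poly_Mapping.single (Poly_Mapping.single i 1) 1"

definition mon_deg :: "(3 \<Rightarrow>\<^sub>0 nat) \<Rightarrow> nat" where
  "mon_deg m = (\<Sum>i\<in>UNIV. Poly_Mapping.lookup m i)"

definition eval3 :: "poly3 \<Rightarrow> complex ^ 3 \<Rightarrow> complex" where
  "eval3 p v = (\<Sum>m\<in>Poly_Mapping.keys p.
     Poly_Mapping.lookup p m * (\<Prod>i\<in>UNIV. (v $ i) ^ Poly_Mapping.lookup m i))"

definition pd :: "3 \<Rightarrow> poly3 \<Rightarrow> poly3" where
  "pd i p = (\<Sum>m\<in>Poly_Mapping.keys p.
     Poly_Mapping.single (m - Poly_Mapping.single i 1)
       (of_nat (Poly_Mapping.lookup m i) * Poly_Mapping.lookup p m))"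

definition homog_comp :: "nat \<Rightarrow> poly3 set" where
  "homog_comp k = {p. \<forall>m\<in>Poly_Mapping.keys p. mon_deg m = k}"

text \<open>Homogenization to degree \<open>d\<close> with respect to the variable \<open>i\<close>; meaningful only for
  polynomials of degree at most \<open>d\<close> that do not involve that variable.\<close>

definition homogenize :: "3 \<Rightarrow> nat \<Rightarrow> poly3 \<Rightarrow> poly3" where
  "homogenize i d p = (\<Sum>m\<in>Poly_Mapping.keys p.
     Poly_Mapping.single (m + Poly_Mapping.single i (d - mon_deg m)) (Poly_Mapping.lookup p m))"

definition cheb_at :: "nat \<Rightarrow> 3 \<Rightarrow> poly3" where
  "cheb_at d i = poly (map_poly (\<lambda>c. Const (complex_of_real c)) (cheb d)) (Var i)"

definition cheb_form :: "nat \<Rightarrow> poly3" where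
  "cheb_form d = homogenize 3 d (cheb_at d 1 + cheb_at d 2)"

section \<open>Plane projective curves and nodes\<close>

definition proj_rel :: "((complex ^ 3) \<times> (complex ^ 3)) set" where
  "proj_rel = {(v, w). v \<noteq> 0 \<and> w \<noteq> 0 \<and> (\<exists>c. c \<noteq> 0 \<and> w = c *s v)}"

definition proj_plane :: "(complex ^ 3) set set" where
  "proj_plane = (UNIV - {0}) // proj_rel"

text \<open>In the next two definitions \<open>f\<close> is understood to be homogeneous, so that vanishing does
  not depend on the representative of a point.\<close>

definition proj_curve :: "poly3 \<Rightarrow> (complex ^ 3) set set" where
  "proj_curve f = {P \<in> proj_plane. \<forall>v\<in>P. eval3 f v = 0}"

definition sing_locus :: "poly3 \<Rightarrow> (complex ^ 3) set set" where
  "sing_locus f = {P \<in> proj_curve f. \<forall>v\<in>P. \<forall>i. eval3 (pd i f) v = 0}"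

text \<open>Complex differentiability: the real derivative has to be given by a complex matrix.\<close>

definition holomorphic2_on :: "(complex ^ 2 \<Rightarrow> complex ^ 2) \<Rightarrow> (complex ^ 2) set \<Rightarrow> bool" where
  "holomorphic2_on \<phi> U \<longleftrightarrow> open U \<and>
     (\<forall>w\<in>U. \<exists>A :: complex ^ 2 ^ 2. (\<phi> has_derivative (\<lambda>h. A *v h)) (at w))"

text \<open>The germ of \<open>g\<close> at \<open>p\<close> is an \<open>A\<^sub>1\<close>-singularity: in suitable local holomorphic
  coordinates centred at \<open>p\<close> it is the sum of the squares of the coordinates. Allowing an
  additional nonvanishing holomorphic factor would not change the notion, since the factor has a
  local square root that can be absorbed into the coordinates.\<close>

definition A1_at :: "(complex ^ 2 \<Rightarrow> complex) \<Rightarrow> complex ^ 2 \<Rightarrow> bool" where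
  "A1_at g p \<longleftrightarrow> (\<exists>U V \<phi> \<psi>.
     p \<in> U \<and> homeomorphism U V \<phi> \<psi> \<and> holomorphic2_on \<phi> U \<and> holomorphic2_on \<psi> V \<and>
     \<phi> p = 0 \<and> (\<forall>w\<in>U. g w = (\<phi> w $ 1)\<^sup>2 + (\<phi> w $ 2)\<^sup>2))"

text \<open>The parametrizations of the standard affine charts of the projective plane.\<close>

definition affine_charts :: "(complex ^ 2 \<Rightarrow> complex ^ 3) set" where
  "affine_charts =
     {\<lambda>w. vector [1, w $ 1, w $ 2], \<lambda>w. vector [w $ 1, 1, w $ 2], \<lambda>w. vector [w $ 1, w $ 2, 1]}"

text \<open>Whether a point is a node does not depend on the chart: a change of charts is
  biholomorphic and multiplies the local equation by a nonvanishing factor.\<close>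

definition is_node :: "poly3 \<Rightarrow> (complex ^ 3) set \<Rightarrow> bool" where
  "is_node f P \<longleftrightarrow> (\<exists>\<kappa>\<in>affine_charts. \<exists>p. \<kappa> p \<in> P \<and> A1_at (\<lambda>w. eval3 f (\<kappa> w)) p)"

definition has_nodes_as_singularities :: "poly3 \<Rightarrow> nat \<Rightarrow> bool" where
  "has_nodes_as_singularities f n \<longleftrightarrow>
     finite (sing_locus f) \<and> card (sing_locus f) = n \<and> (\<forall>P\<in>sing_locus f. is_node f P)"

section \<open>The graded Milnor algebra\<close>

definition poly3_ring :: "poly3 ring" where
  "poly3_ring = ring_of_type_algebra"

definition jacobian_ideal :: "poly3 \<Rightarrow> poly3 set" where
  "jacobian_ideal f = Idl\<^bsub>poly3_ring\<^esub> {pd 1 f, pd 2 f, pd 3 f}"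

definition milnor_algebra :: "poly3 \<Rightarrow> poly3 set ring" where
  "milnor_algebra f = poly3_ring Quot jacobian_ideal f"

definition milnor_class :: "poly3 \<Rightarrow> poly3 \<Rightarrow> poly3 set" where
  "milnor_class f p = jacobian_ideal f +>\<^bsub>poly3_ring\<^esub> p"

text \<open>The image of the ground field; all zero if the Milnor algebra is the zero ring.\<close>

definition milnor_scalars :: "poly3 \<Rightarrow> poly3 set set" where
  "milnor_scalars f = milnor_class f ` range Const"

definition milnor_comp :: "poly3 \<Rightarrow> nat \<Rightarrow> poly3 set set" where
  "milnor_comp f k = milnor_class f ` homog_comp k"

definition milnor_comp_has_dim :: "poly3 \<Rightarrow> nat \<Rightarrow> nat \<Rightarrow> bool" where
  "milnor_comp_has_dim f k n \<longleftrightarrow>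
     ring.dimension (milnor_algebra f) n (milnor_scalars f) (milnor_comp f k)"

end

theory Submission
  imports Defs "HOL-Complex_Analysis.Conformal_Mappings"
begin

text \<open>Put \<open>d = n + 1\<close> and let \<open>x\<^sub>1, \<dots>, x\<^sub>n\<close>, where \<open>x\<^sub>i = cos (i \<pi> / d)\<close>, be the critical points of
  \<open>T\<^sub>d\<close>. They are simple and \<open>T\<^sub>d(x\<^sub>i) = (-1)\<^sup>i\<close>, so the common zeros of \<open>f\<^sub>x\<close> and \<open>f\<^sub>y\<close> are the
  \<open>n\<^sup>2\<close> grid points \<open>(x\<^sub>i : x\<^sub>j : 1)\<close>, and \<open>f\<^sub>z\<close> vanishes exactly at those with \<open>i + j\<close> odd. At such
  a point \<open>T\<^sub>d(x) + T\<^sub>d(y)\<close> is the sum of the squares of two local coordinates, one in each variable.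

  Reduction modulo \<open>f\<^sub>x\<close> and \<open>f\<^sub>y\<close> leaves forms of degree less than \<open>n\<close> in \<open>x\<close> and in \<open>y\<close>, hence a
  form vanishing on the whole grid lies in \<open>(f\<^sub>x, f\<^sub>y)\<close>. A form \<open>p\<close> of degree \<open>k \<ge> 2 n - 1\<close> that only
  vanishes at the odd points becomes such a form after subtracting \<open>q f\<^sub>z\<close>, where \<open>q\<close> has degree
  \<open>k - n \<ge> n - 1\<close> and interpolates \<open>p / f\<^sub>z\<close> at the even points. So evaluation identifies the
  degree \<open>k\<close> part of the Milnor algebra with the functions on the odd points.\<close>

no_notation fps_nth (infixl "$" 75)

section \<open>Polynomials in three variables\<close>

text \<open>The support of \<open>p + q\<close> can be smaller than the union of both supports, so
  all three sums are first extended to that union by zero terms. Additivity of \<open>eval3\<close>,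
  \<open>pd\<close> and \<open>homogenize\<close> follows from this one fact.\<close>

lemma sum_keys_add:
  fixes F :: "'a \<Rightarrow> 'b::monoid_add \<Rightarrow> 'c::comm_monoid_add" and p q :: "'a \<Rightarrow>\<^sub>0 'b"
  assumes "\<And>m. F m 0 = 0" "\<And>m a b. F m (a + b) = F m a + F m b"
  shows "(\<Sum>m\<in>Poly_Mapping.keys (p + q). F m (Poly_Mapping.lookup (p + q) m)) =
    (\<Sum>m\<in>Poly_Mapping.keys p. F m (Poly_Mapping.lookup p m)) +
    (\<Sum>m\<in>Poly_Mapping.keys q. F m (Poly_Mapping.lookup q m))"
proof -
  let ?K = "Poly_Mapping.keys p \<union> Poly_Mapping.keys q"
  have *: "(\<Sum>m\<in>Poly_Mapping.keys r. F m (Poly_Mapping.lookup r m)) =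
      (\<Sum>m\<in>?K. F m (Poly_Mapping.lookup r m))" if "Poly_Mapping.keys r \<subseteq> ?K" for r
    by (rule sum.mono_neutral_left) (use that in \<open>auto simp: assms(1) in_keys_iff\<close>)
  show ?thesis
    by (subst (1 2 3) *)
      (use Poly_Mapping.keys_add[of p q] in \<open>auto simp: assms(2) lookup_add sum.distrib\<close>)
qed

lemma poly_mapping_monomials_induct [case_names single add]:
  fixes p :: "'a \<Rightarrow>\<^sub>0 'b::monoid_add"
  assumes "\<And>m c. P (Poly_Mapping.single m c)" "\<And>p q. P p \<Longrightarrow> P q \<Longrightarrow> P (p + q)"
  shows "P p"
proof (induction p rule: update_induct)
  case const
  show ?case using assms(1)[of undefined 0] by simp
next
  case (update p a b)
  have "Poly_Mapping.update a b p = p + Poly_Mapping.single a b"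
    using update.hyps(1)
    by (intro poly_mapping_eqI) (auto simp: lookup_update lookup_add lookup_single in_keys_iff)
  then show ?case using assms update.IH by simp
qed

lemma poly_mapping_expand:
  "(\<Sum>m\<in>Poly_Mapping.keys p. Poly_Mapping.single m (Poly_Mapping.lookup p m)) = p"
  by (intro poly_mapping_eqI) (auto simp: lookup_sum lookup_single when_def in_keys_iff)

lemma mon_deg_add [simp]: "mon_deg (m + m') = mon_deg m + mon_deg m'"
  by (simp add: mon_deg_def lookup_add sum.distrib)

lemma mon_deg_single [simp]: "mon_deg (Poly_Mapping.single i j) = j"
  by (simp add: mon_deg_def lookup_single when_def)

lemma mon_deg_zero [simp]: "mon_deg 0 = 0"
  by (simp add: mon_deg_def)

lemma eval3_add [simp]: "eval3 (p + q) v = eval3 p v + eval3 q v"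
  unfolding eval3_def
  by (rule sum_keys_add[where F = "\<lambda>m c. c * (\<Prod>i\<in>UNIV. (v $ i) ^ Poly_Mapping.lookup m i)"])
    (auto simp: algebra_simps)

lemma eval3_single:
  "eval3 (Poly_Mapping.single m c) v = c * (\<Prod>i\<in>UNIV. (v $ i) ^ Poly_Mapping.lookup m i)"
  by (simp add: eval3_def)

lemma eval3_zero [simp]: "eval3 0 v = 0"
  by (simp add: eval3_def)

lemma eval3_minus [simp]: "eval3 (p - q) v = eval3 p v - eval3 q v"
  by (metis add_diff_cancel_right' diff_add_cancel eval3_add)

lemma eval3_sum: "eval3 (\<Sum>i\<in>A. f i) v = (\<Sum>i\<in>A. eval3 (f i) v)"
  by (induction A rule: infinite_finite_induct) auto

lemma eval3_mult [simp]: "eval3 (p * q) v = eval3 p v * eval3 q v"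
proof (induction p rule: poly_mapping_monomials_induct)
  case (single m c)
  show ?case
    by (induction q rule: poly_mapping_monomials_induct)
      (auto simp: mult_single eval3_single lookup_add power_add prod.distrib algebra_simps)
qed (auto simp: algebra_simps)

lemma eval3_Const [simp]: "eval3 (Const c) v = c"
  by (simp add: Const_def eval3_single)

lemma prod_power_lookup_single:
  "(\<Prod>i\<in>UNIV. (v $ i :: complex) ^ Poly_Mapping.lookup (Poly_Mapping.single k j) i) = v $ k ^ j"
proof -
  have "v $ i ^ Poly_Mapping.lookup (Poly_Mapping.single k j) i = (if i = k then v $ k ^ j else 1)"
    for i by (auto simp: lookup_single when_def)
  then show ?thesis by simp
qed

lemma eval3_Var [simp]: "eval3 (Var i) v = v $ i"
  by (simp add: Var_def eval3_single prod_power_lookup_single)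

lemma eval3_power [simp]: "eval3 (p ^ n) v = eval3 p v ^ n"
  by (induction n) (auto simp: eval3_single simp flip: single_one)

lemma Const_mult_single: "Const c * Poly_Mapping.single m b = Poly_Mapping.single m (c * b)"
  by (simp add: Const_def mult_single)

lemma Var_power: "Var i ^ j = Poly_Mapping.single (Poly_Mapping.single i j) 1"
  by (induction j) (auto simp: Var_def mult_single simp flip: single_add)

lemma pd_add: "pd i (p + q) = pd i p + pd i q"
  unfolding pd_def
  by (rule sum_keys_add[where F = "\<lambda>m c. Poly_Mapping.single (m - Poly_Mapping.single i 1)
       (of_nat (Poly_Mapping.lookup m i) * c)"]) (auto simp: algebra_simps single_add)

lemma pd_single: "pd i (Poly_Mapping.single m c) =
    Poly_Mapping.single (m - Poly_Mapping.single i 1) (of_nat (Poly_Mapping.lookup m i) * c)"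
  by (simp add: pd_def)

lemma pd_zero [simp]: "pd i 0 = 0"
  by (simp add: pd_def)

lemma pd_sum: "pd i (\<Sum>j\<in>A. f j) = (\<Sum>j\<in>A. pd i (f j))"
  by (induction A rule: infinite_finite_induct) (auto simp: pd_add)

lemma homogenize_add: "homogenize i d (p + q) = homogenize i d p + homogenize i d q"
  unfolding homogenize_def
  by (rule sum_keys_add[where F = "\<lambda>m c. Poly_Mapping.single (m + Poly_Mapping.single i (d - mon_deg m)) c"])
    (auto simp: single_add)

lemma homogenize_single: "homogenize i d (Poly_Mapping.single m c) =
    Poly_Mapping.single (m + Poly_Mapping.single i (d - mon_deg m)) c"
  by (simp add: homogenize_def)

lemma homogenize_zero [simp]: "homogenize i d 0 = 0"
  by (simp add: homogenize_def)

lemma homogenize_sum: "homogenize i d (\<Sum>j\<in>A. f j) = (\<Sum>j\<in>A. homogenize i d (f j))"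
  by (induction A rule: infinite_finite_induct) (auto simp: homogenize_add)

lemma homog_comp_single: "mon_deg m = k \<Longrightarrow> Poly_Mapping.single m c \<in> homog_comp k"
  by (simp add: homog_comp_def)

lemma homog_comp_zero [simp]: "0 \<in> homog_comp k"
  by (simp add: homog_comp_def)

lemma homog_comp_add: "p \<in> homog_comp k \<Longrightarrow> q \<in> homog_comp k \<Longrightarrow> p + q \<in> homog_comp k"
  using Poly_Mapping.keys_add[of p q] by (fastforce simp: homog_comp_def)

lemma homog_comp_mult: "p \<in> homog_comp k \<Longrightarrow> q \<in> homog_comp l \<Longrightarrow> p * q \<in> homog_comp (k + l)"
  using Poly_Mapping.keys_mult[of p q] by (fastforce simp: homog_comp_def)

lemma homog_comp_Const: "Const c \<in> homog_comp 0"
  by (simp add: Const_def homog_comp_single)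

lemma homog_comp_Const_mult: "p \<in> homog_comp k \<Longrightarrow> Const c * p \<in> homog_comp k"
  using homog_comp_mult[OF homog_comp_Const] by fastforce

lemma homog_comp_minus: "p \<in> homog_comp k \<Longrightarrow> q \<in> homog_comp k \<Longrightarrow> p - q \<in> homog_comp k"
  using Poly_Mapping.keys_diff[of p q] by (fastforce simp: homog_comp_def)

lemma homog_comp_Var_power: "Var i ^ j \<in> homog_comp j"
  by (simp add: Var_power homog_comp_single)

lemma homog_comp_sum: "(\<And>i. i \<in> A \<Longrightarrow> f i \<in> homog_comp k) \<Longrightarrow> (\<Sum>i\<in>A. f i) \<in> homog_comp k"
  by (induction A rule: infinite_finite_induct) (auto intro: homog_comp_add)

section \<open>Homogenized univariate polynomials\<close>

text \<open>If \<open>P\<close> has degree at most \<open>e\<close>, this is the form z^e P(x_i /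
  z). As \<open>e\<close> is independent of the degree of \<open>P\<close>, partial derivatives can
  be written as \<open>hom_poly\<close> again.\<close>

definition hom_poly :: "3 \<Rightarrow> nat \<Rightarrow> complex poly \<Rightarrow> poly3" where
  "hom_poly i e P = (\<Sum>j\<le>e.
     Poly_Mapping.single (Poly_Mapping.single i j + Poly_Mapping.single 3 (e - j)) (coeff P j))"

lemma eval3_hom_poly: "eval3 (hom_poly i e P) v = (\<Sum>j\<le>e. coeff P j * v $ i ^ j * v $ 3 ^ (e - j))"
  by (simp add: hom_poly_def eval3_sum eval3_single lookup_add power_add prod.distrib
      prod_power_lookup_single algebra_simps)

lemma poly_sum_atMost:
  fixes P :: "'a::comm_semiring_1 poly"
  assumes "degree P \<le> e"
  shows "poly P x = (\<Sum>j\<le>e. coeff P j * x ^ j)"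
proof -
  have "(\<Sum>j\<le>degree P. coeff P j * x ^ j) = (\<Sum>j\<le>e. coeff P j * x ^ j)"
    by (rule sum.mono_neutral_left) (use assms in \<open>auto simp: coeff_eq_0\<close>)
  then show ?thesis by (simp add: poly_altdef)
qed

lemma eval3_hom_poly_affine:
  "degree P \<le> e \<Longrightarrow> v $ 3 = 1 \<Longrightarrow> eval3 (hom_poly i e P) v = poly P (v $ i)"
  by (simp add: eval3_hom_poly poly_sum_atMost)

lemma homog_comp_hom_poly: "hom_poly i e P \<in> homog_comp e"
  unfolding hom_poly_def by (intro homog_comp_sum homog_comp_single) auto

lemma three_distinct [simp]: "(1::3) \<noteq> 3" "(2::3) \<noteq> 3" "(1::3) \<noteq> 2" "(3::3) \<noteq> 1" "(3::3) \<noteq> 2" "(2::3) \<noteq> 1"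
  by auto

lemma pd_hom_poly_self:
  assumes "i \<noteq> 3"
  shows "pd i (hom_poly i (Suc n) P) = hom_poly i n (pderiv P)"
proof -
  have "pd i (hom_poly i (Suc n) P) = (\<Sum>j\<le>Suc n.
     Poly_Mapping.single (Poly_Mapping.single i (j - 1) + Poly_Mapping.single 3 (Suc n - j)) (of_nat j * coeff P j))"
    unfolding hom_poly_def pd_sum
  proof (rule sum.cong)
    fix j assume "j \<in> {..Suc n}"
    have "j > 0 \<Longrightarrow> Poly_Mapping.single i j + Poly_Mapping.single 3 (Suc n - j) - Poly_Mapping.single i 1 =
        Poly_Mapping.single i (j - 1) + Poly_Mapping.single 3 (Suc n - j)"
      using assms by (intro poly_mapping_eqI) (auto simp: lookup_minus lookup_add lookup_single when_def)
    then show "pd i (Poly_Mapping.single (Poly_Mapping.single i j + Poly_Mapping.single 3 (Suc n - j)) (coeff P j)) =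
        Poly_Mapping.single (Poly_Mapping.single i (j - 1) + Poly_Mapping.single 3 (Suc n - j)) (of_nat j * coeff P j)"
      using assms by (cases j) (simp_all add: pd_single lookup_add lookup_single)
  qed auto
  also have "\<dots> = hom_poly i n (pderiv P)"
    by (simp add: sum.atMost_Suc_shift hom_poly_def coeff_pderiv del: sum.atMost_Suc)
  finally show ?thesis .
qed

lemma pd_hom_poly_other:
  assumes "i \<noteq> k" "k \<noteq> 3"
  shows "pd k (hom_poly i e P) = 0"
  using assms by (auto simp: hom_poly_def pd_sum pd_single lookup_add lookup_single)

text \<open>Euler's relation z F_z = (n + 1) F - x_i F_(x_i), read at z = 1. Coefficientwise the
  factor n + 1 - j splits into its two parts.\<close>

lemma pd_3_hom_poly:
  assumes "i \<noteq> 3"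
  shows "pd 3 (hom_poly i (Suc n) P) = hom_poly i n (smult (of_nat (Suc n)) P - pCons 0 (pderiv P))"
proof -
  have "pd 3 (hom_poly i (Suc n) P) = (\<Sum>j\<le>Suc n.
     Poly_Mapping.single (Poly_Mapping.single i j + Poly_Mapping.single 3 (Suc n - j - 1)) (of_nat (Suc n - j) * coeff P j))"
    unfolding hom_poly_def pd_sum
  proof (rule sum.cong)
    fix j assume "j \<in> {..Suc n}"
    have "Poly_Mapping.single i j + Poly_Mapping.single 3 (Suc n - j) - Poly_Mapping.single 3 1 =
        Poly_Mapping.single i j + Poly_Mapping.single 3 (Suc n - j - 1)"
      using assms by (intro poly_mapping_eqI) (auto simp: lookup_minus lookup_add lookup_single when_def)
    then show "pd 3 (Poly_Mapping.single (Poly_Mapping.single i j + Poly_Mapping.single 3 (Suc n - j)) (coeff P j)) =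
        Poly_Mapping.single (Poly_Mapping.single i j + Poly_Mapping.single 3 (Suc n - j - 1)) (of_nat (Suc n - j) * coeff P j)"
      using assms by (simp add: pd_single lookup_add lookup_single)
  qed auto
  also have "\<dots> = (\<Sum>j\<le>n. Poly_Mapping.single (Poly_Mapping.single i j + Poly_Mapping.single 3 (n - j)) (of_nat (Suc n - j) * coeff P j))"
    by simp
  also have "\<dots> = hom_poly i n (smult (of_nat (Suc n)) P - pCons 0 (pderiv P))"
    unfolding hom_poly_def
  proof (intro sum.cong refl arg_cong2[where f = Poly_Mapping.single])
    fix j assume "j \<in> {..n}"
    have "coeff (pCons 0 (pderiv P)) j = of_nat j * coeff P j"
      by (cases j) (auto simp: coeff_pderiv)
    then show "of_nat (Suc n - j) * coeff P j = coeff (smult (of_nat (Suc n)) P - pCons 0 (pderiv P)) j"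
      using \<open>j \<in> {..n}\<close> by (simp add: of_nat_diff algebra_simps)
  qed
  finally show ?thesis .
qed

section \<open>Chebyshev polynomials\<close>

lemma degree_cheb [simp]: "degree (cheb d) = d"
  and poly_cheb: "x \<in> {-1..1} \<Longrightarrow> poly (cheb d) x = cos (real d * arccos x)"
  using theI'[OF cheb_unique_existence[of d]] unfolding cheb_def by auto

lemma poly_cheb_cos: "t \<in> {0..pi} \<Longrightarrow> poly (cheb d) (cos t) = cos (real d * t)"
  by (subst poly_cheb) (auto simp: arccos_cos)

text \<open>Differentiate T_d(cos t) = cos(d t). That identity is available only for t in [0, pi],
  hence the transfer of the derivative within the open interval.\<close>

lemma poly_pderiv_cheb_cos:
  assumes "t \<in> {0<..<pi}"
  shows "poly (pderiv (cheb d)) (cos t) * sin t = real d * sin (real d * t)"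
proof -
  have "((\<lambda>t. poly (cheb d) (cos t)) has_real_derivative poly (pderiv (cheb d)) (cos t) * (- sin t)) (at t)"
    by (rule DERIV_chain2[OF poly_DERIV]) (auto intro!: derivative_eq_intros)
  moreover have "((\<lambda>t. cos (real d * t)) has_real_derivative - sin (real d * t) * real d) (at t)"
    by (auto intro!: derivative_eq_intros)
  then have "((\<lambda>t. poly (cheb d) (cos t)) has_real_derivative - sin (real d * t) * real d) (at t)"
    by (rule has_field_derivative_transform_within_open[where S = "{0<..<pi}"])
      (use assms in \<open>auto simp: poly_cheb_cos\<close>)
  ultimately show ?thesis
    by (auto dest: DERIV_unique)
qed

text \<open>The preceding identity differentiated once more. At a critical point the T_d' term
  disappears and T_d'' can be read off.\<close>

lemma poly_pderiv2_cheb_cos: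
  assumes "t \<in> {0<..<pi}"
  shows "poly (pderiv (cheb d)) (cos t) * cos t - poly (pderiv (pderiv (cheb d))) (cos t) * (sin t)\<^sup>2
    = (real d)\<^sup>2 * cos (real d * t)"
proof -
  have "((\<lambda>t. poly (pderiv (cheb d)) (cos t)) has_real_derivative
      poly (pderiv (pderiv (cheb d))) (cos t) * (- sin t)) (at t)"
    by (rule DERIV_chain2[OF poly_DERIV]) (auto intro!: derivative_eq_intros)
  from DERIV_mult[OF this DERIV_sin]
  have "((\<lambda>t. poly (pderiv (cheb d)) (cos t) * sin t) has_real_derivative
      poly (pderiv (cheb d)) (cos t) * cos t - poly (pderiv (pderiv (cheb d))) (cos t) * (sin t)\<^sup>2) (at t)"
    by (simp add: power2_eq_square algebra_simps)
  moreover have "((\<lambda>t. real d * sin (real d * t)) has_real_derivative (real d)\<^sup>2 * cos (real d * t)) (at t)"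
    by (auto intro!: derivative_eq_intros simp: power2_eq_square)
  then have "((\<lambda>t. poly (pderiv (cheb d)) (cos t) * sin t) has_real_derivative
      (real d)\<^sup>2 * cos (real d * t)) (at t)"
    by (rule has_field_derivative_transform_within_open[where S = "{0<..<pi}"])
      (use assms in \<open>auto simp: poly_pderiv_cheb_cos\<close>)
  ultimately show ?thesis
    by (rule DERIV_unique)
qed

section \<open>Critical points of the complex Chebyshev polynomial\<close>

definition ccheb :: "nat \<Rightarrow> complex poly" where
  "ccheb d = map_poly complex_of_real (cheb d)"

lemma coeff_ccheb: "coeff (ccheb d) j = complex_of_real (coeff (cheb d) j)"
  by (simp add: ccheb_def coeff_map_poly)

lemma degree_ccheb [simp]: "degree (ccheb d) = d"
  unfolding ccheb_def by (subst degree_map_poly) auto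

lemma poly_map_poly_complex_of_real:
  "poly (map_poly complex_of_real p) (complex_of_real x) = complex_of_real (poly p x)"
  by (induction p) (auto simp: map_poly_pCons)

lemma pderiv_map_poly_complex_of_real:
  "pderiv (map_poly complex_of_real p) = map_poly complex_of_real (pderiv p)"
  by (intro poly_eqI) (simp add: coeff_pderiv coeff_map_poly)

lemma cheb_at_eq: "cheb_at d i = (\<Sum>j\<le>d. Poly_Mapping.single (Poly_Mapping.single i j) (coeff (ccheb d) j))"
proof -
  have 0: "Const 0 = 0" by (simp add: Const_def)
  have deg: "degree (map_poly (\<lambda>c. Const (complex_of_real c)) (cheb d)) \<le> d"
    by (intro degree_le) (simp add: coeff_map_poly 0 coeff_eq_0)
  show ?thesis
    unfolding cheb_at_def poly_sum_atMost[OF deg]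
    by (simp add: coeff_map_poly 0 Var_power Const_mult_single coeff_ccheb)
qed

lemma cheb_form_eq: "cheb_form d = hom_poly 1 d (ccheb d) + hom_poly 2 d (ccheb d)"
  by (simp add: cheb_form_def homogenize_add cheb_at_eq homogenize_sum homogenize_single hom_poly_def)

definition cheb_crit :: "nat \<Rightarrow> nat \<Rightarrow> complex" where
  "cheb_crit d i = complex_of_real (cos (real i * pi / real d))"

context
  fixes n i :: nat
  assumes i: "i \<in> {1..n}"
begin

lemma angle_bounds: "real i * pi / real (Suc n) \<in> {0<..<pi}"
proof -
  have "real i * pi < real (Suc n) * pi" using i by simp
  then show ?thesis using i by (auto simp: field_simps)
qed

lemma sin_angle_pos: "sin (real i * pi / real (Suc n)) > 0"
  using angle_bounds by (intro sin_gt_zero) auto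

lemma poly_ccheb_crit: "poly (ccheb (Suc n)) (cheb_crit (Suc n) i) = (-1) ^ i"
  using angle_bounds
  by (simp add: ccheb_def cheb_crit_def poly_map_poly_complex_of_real poly_cheb_cos cos_npi del: of_nat_Suc)

lemma poly_pderiv_ccheb_crit: "poly (pderiv (ccheb (Suc n))) (cheb_crit (Suc n) i) = 0"
  using poly_pderiv_cheb_cos[OF angle_bounds, of "Suc n"] sin_angle_pos
  by (simp add: ccheb_def cheb_crit_def poly_map_poly_complex_of_real pderiv_map_poly_complex_of_real
      del: of_nat_Suc)

text \<open>As T' = 0 here, T'' = 0 would leave (n + 1)^2 cos(i pi) = 0 in the second-derivative
  identity, whereas cos(i pi) is 1 or -1.\<close>

lemma poly_pderiv2_ccheb_crit: "poly (pderiv (pderiv (ccheb (Suc n)))) (cheb_crit (Suc n) i) \<noteq> 0"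
proof
  assume "poly (pderiv (pderiv (ccheb (Suc n)))) (cheb_crit (Suc n) i) = 0"
  moreover have "poly (pderiv (cheb (Suc n))) (cos (real i * pi / real (Suc n))) = 0"
    using poly_pderiv_ccheb_crit
    by (simp add: ccheb_def cheb_crit_def poly_map_poly_complex_of_real pderiv_map_poly_complex_of_real
      del: of_nat_Suc)
  ultimately have "(real (Suc n))\<^sup>2 * cos (real i * pi) = 0"
    using poly_pderiv2_cheb_cos[OF angle_bounds, of "Suc n"]
    by (simp add: ccheb_def cheb_crit_def poly_map_poly_complex_of_real pderiv_map_poly_complex_of_real
      del: of_nat_Suc)
  then show False by (simp del: of_nat_Suc)
qed

end

lemma inj_on_cheb_crit: "inj_on (cheb_crit (Suc n)) {1..n}"
proof (rule inj_onI)
  fix i j assume ij: "i \<in> {1..n}" "j \<in> {1..n}" and "cheb_crit (Suc n) i = cheb_crit (Suc n) j"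
  then have "cos (real i * pi / real (Suc n)) = cos (real j * pi / real (Suc n))"
    by (simp add: cheb_crit_def del: of_nat_Suc)
  then have "real i * pi / real (Suc n) = real j * pi / real (Suc n)"
    by (rule cos_inj_pi[rotated -1]) (use angle_bounds[OF ij(1)] angle_bounds[OF ij(2)] in auto)
  then show "i = j" by (simp del: of_nat_Suc)
qed

lemma degree_pderiv_ccheb [simp]: "degree (pderiv (ccheb d)) = d - 1"
  by (simp add: degree_pderiv)

lemma pderiv_ccheb_nonzero: "pderiv (ccheb (Suc n)) \<noteq> 0"
  by (simp add: pderiv_eq_0_iff)

text \<open>The n distinct real critical points already exhaust the degree n of the derivative, so
  there are no further complex ones.\<close>

lemma poly_pderiv_ccheb_eq_0_iff:
  "poly (pderiv (ccheb (Suc n))) x = 0 \<longleftrightarrow> x \<in> cheb_crit (Suc n) ` {1..n}"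
proof -
  let ?R = "{x. poly (pderiv (ccheb (Suc n))) x = 0}"
  have "cheb_crit (Suc n) ` {1..n} = ?R"
  proof (rule card_seteq)
    show "finite ?R" by (rule poly_roots_finite[OF pderiv_ccheb_nonzero])
    show "cheb_crit (Suc n) ` {1..n} \<subseteq> ?R" using poly_pderiv_ccheb_crit by auto
    show "card ?R \<le> card (cheb_crit (Suc n) ` {1..n})"
      using card_poly_roots_bound[OF pderiv_ccheb_nonzero, of n] card_image[OF inj_on_cheb_crit, of n]
      by simp
  qed
  then show ?thesis by auto
qed

text \<open>U_a, the Chebyshev polynomial of the second kind, through T_(a+1)' = (a + 1)
  U_a.\<close>

definition chebU :: "nat \<Rightarrow> complex poly" where
  "chebU a = smult (1 / of_nat (Suc a)) (pderiv (ccheb (Suc a)))"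

lemma degree_chebU [simp]: "degree (chebU a) = a"
  by (simp add: chebU_def del: of_nat_Suc)

lemma chebU_nonzero [simp]: "chebU a \<noteq> 0"
  using pderiv_ccheb_nonzero by (simp add: chebU_def del: of_nat_Suc)

lemma poly_chebU_cos:
  assumes "t \<in> {0<..<pi}"
  shows "poly (chebU a) (complex_of_real (cos t)) = complex_of_real (sin (real (Suc a) * t) / sin t)"
proof -
  have "sin t > 0" using assms by (intro sin_gt_zero) auto
  moreover have "poly (pderiv (cheb (Suc a))) (cos t) = real (Suc a) * sin (real (Suc a) * t) / sin t"
    using poly_pderiv_cheb_cos[OF assms, of "Suc a"] \<open>sin t > 0\<close> by (simp add: field_simps del: of_nat_Suc)
  ultimately show ?thesis
    by (simp add: chebU_def ccheb_def poly_map_poly_complex_of_real pderiv_map_poly_complex_of_real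
        del: of_nat_Suc)
qed

text \<open>For t = i pi / (n + 1) the angles (n - a) t and (a + 1) t add up to i pi, and sin(i pi -
  s) = (-1)^(i+1) sin s.\<close>

lemma poly_chebU_crit_reflect:
  assumes "i \<in> {1..n}" "a < n"
  shows "poly (chebU (n - 1 - a)) (cheb_crit (Suc n) i) = (-1) ^ Suc i * poly (chebU a) (cheb_crit (Suc n) i)"
proof -
  define t where "t = real i * pi / real (Suc n)"
  have "real (Suc (n - 1 - a)) * t = real i * pi - real (Suc a) * t"
    using assms(2) by (simp add: t_def of_nat_diff field_simps)
  then have "sin (real (Suc (n - 1 - a)) * t) = (-1) ^ Suc i * sin (real (Suc a) * t)"
    by (simp add: sin_diff del: of_nat_Suc)
  then show ?thesis
    using angle_bounds[OF assms(1)] by (simp add: cheb_crit_def poly_chebU_cos flip: t_def del: of_nat_Suc)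
qed

text \<open>There is exactly one U_a in each degree a, so leading coefficients can be removed one at
  a time. The alternative \<open>P = 0\<close> provides the base case n = 0.\<close>

lemma chebU_basis:
  assumes "degree P < n \<or> P = 0"
  shows "\<exists>c. P = (\<Sum>a<n. smult (c a) (chebU a))"
  using assms
proof (induction n arbitrary: P)
  case (Suc n)
  define c where "c = coeff P n / lead_coeff (chebU n)"
  define Q where "Q = P - smult c (chebU n)"
  have "coeff Q j = 0" if "j \<ge> n" for j
  proof (cases "j = n")
    case True
    have "lead_coeff (chebU n) \<noteq> 0" by (simp only: leading_coeff_0_iff chebU_nonzero not_False_eq_True)
    then show ?thesis using True by (simp add: Q_def c_def)
  next
    case False
    then have "j > n" using that by simp
    then show ?thesis using Suc.prems by (auto simp: Q_def coeff_eq_0)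
  qed
  then have "degree Q < n \<or> Q = 0"
    by (metis leading_coeff_0_iff not_le)
  from Suc.IH[OF this] obtain e where e: "Q = (\<Sum>a<n. smult (e a) (chebU a))" by blast
  have "P = (\<Sum>a<Suc n. smult ((e(n := c)) a) (chebU a))"
    using e by (simp add: Q_def algebra_simps)
  then show ?case by blast
qed auto

section \<open>Forms vanishing on a grid\<close>

lemma hom_poly_degree_eq:
  assumes "degree P = n"
  shows "hom_poly i n P = Poly_Mapping.single (Poly_Mapping.single i n) (lead_coeff P) +
    (\<Sum>j<n. Poly_Mapping.single (Poly_Mapping.single i j + Poly_Mapping.single 3 (n - j)) (coeff P j))"
  using assms by (simp add: hom_poly_def lessThan_Suc_atMost[symmetric])

text \<open>Division with remainder by two forms whose leading terms are powers of x and of y. Only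
  the remainder carries a degree condition; the vanishing argument on the grid is applied to it
  alone.\<close>

definition reducible :: "complex poly \<Rightarrow> nat \<Rightarrow> poly3 \<Rightarrow> bool" where
  "reducible P k p \<longleftrightarrow> (\<exists>u v r. p = u * hom_poly 1 (degree P) P + v * hom_poly 2 (degree P) P + r \<and>
     r \<in> homog_comp k \<and>
     (\<forall>m\<in>Poly_Mapping.keys r. Poly_Mapping.lookup m 1 < degree P \<and> Poly_Mapping.lookup m 2 < degree P))"

lemma reducible_add:
  assumes "reducible P k p" "reducible P k q"
  shows "reducible P k (p + q)"
proof -
  obtain u v r where 1: "p = u * hom_poly 1 (degree P) P + v * hom_poly 2 (degree P) P + r" "r \<in> homog_comp k"
     "\<forall>m\<in>Poly_Mapping.keys r. Poly_Mapping.lookup m 1 < degree P \<and> Poly_Mapping.lookup m 2 < degree P"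
    using assms(1) unfolding reducible_def by blast
  obtain u' v' r' where 2: "q = u' * hom_poly 1 (degree P) P + v' * hom_poly 2 (degree P) P + r'" "r' \<in> homog_comp k"
     "\<forall>m\<in>Poly_Mapping.keys r'. Poly_Mapping.lookup m 1 < degree P \<and> Poly_Mapping.lookup m 2 < degree P"
    using assms(2) unfolding reducible_def by blast
  show ?thesis
    unfolding reducible_def
    by (rule exI[of _ "u + u'"], rule exI[of _ "v + v'"], rule exI[of _ "r + r'"])
      (use 1 2 Poly_Mapping.keys_add[of r r'] in \<open>auto simp: algebra_simps homog_comp_add\<close>)
qed

lemma reducible_zero: "reducible P k 0"
  unfolding reducible_def by (rule exI[of _ 0], rule exI[of _ 0], rule exI[of _ 0]) auto

lemma reducible_sum: "(\<And>i. i \<in> A \<Longrightarrow> reducible P k (f i)) \<Longrightarrow> reducible P k (\<Sum>i\<in>A. f i)"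
  by (induction A rule: infinite_finite_induct) (auto simp: reducible_add reducible_zero)

lemma reducible_mult:
  assumes "i \<in> {1, 2}"
  shows "reducible P k (u * hom_poly i (degree P) P)"
proof (cases "i = 1")
  case True
  then show ?thesis
    unfolding reducible_def by (intro exI[of _ u] exI[of _ 0]) auto
next
  case False
  then have "i = 2" using assms by simp
  then show ?thesis
    unfolding reducible_def by (intro exI[of _ 0] exI[of _ u]) auto
qed

text \<open>Modulo the form of \<open>P\<close>, the power x_i^n with n the degree of
  \<open>P\<close> is a combination of the x_i^j z^(n-j) with j < n. This replacement keeps the
  total degree and lowers the sum of the exponents of x and y, so it terminates.\<close>

lemma reducible_single:
  assumes "P \<noteq> 0" "mon_deg m = k"
  shows "reducible P k (Poly_Mapping.single m c)"
  using assms(2)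
proof (induction "Poly_Mapping.lookup m 1 + Poly_Mapping.lookup m 2" arbitrary: m c rule: less_induct)
  case less
  show ?case
  proof (cases "Poly_Mapping.lookup m 1 < degree P \<and> Poly_Mapping.lookup m 2 < degree P")
    case True
    then show ?thesis
      unfolding reducible_def using less.prems
      by (intro exI[of _ 0] exI[of _ "Poly_Mapping.single m c"]) (auto simp: homog_comp_single)
  next
    case False
    then obtain i :: 3 where i: "i \<in> {1, 2}" "Poly_Mapping.lookup m i \<ge> degree P"
      by (metis insertCI not_le)
    define n where "n = degree P"
    define m' where "m' = m - Poly_Mapping.single i n"
    have m: "m = m' + Poly_Mapping.single i n"
      using i(2) by (intro poly_mapping_eqI)
        (auto simp: m'_def n_def lookup_add lookup_minus lookup_single when_def)
    define c' where "c' = c / lead_coeff P"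
    \<comment> \<open>The \<open>t j\<close> add up to what is left of the monomial after
      subtracting the multiple of the form with the same leading term.\<close>
    define t where "t j = Poly_Mapping.single
        (m' + (Poly_Mapping.single i j + Poly_Mapping.single 3 (n - j))) (- c' * coeff P j)" for j
    have "t j = - (Poly_Mapping.single m' c' *
        Poly_Mapping.single (Poly_Mapping.single i j + Poly_Mapping.single 3 (n - j)) (coeff P j))" for j
      by (simp add: t_def mult_single single_uminus)
    then have t: "(\<Sum>j<n. t j) = - (Poly_Mapping.single m' c' *
        (\<Sum>j<n. Poly_Mapping.single (Poly_Mapping.single i j + Poly_Mapping.single 3 (n - j)) (coeff P j)))"
      by (simp add: sum_distrib_left sum_negf)
    have "Poly_Mapping.single m c = Poly_Mapping.single m' c' * Poly_Mapping.single (Poly_Mapping.single i n) (lead_coeff P)"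
      using assms(1) by (simp add: mult_single c'_def flip: m)
    then have "Poly_Mapping.single m c = Poly_Mapping.single m' c' * hom_poly i n P + (\<Sum>j<n. t j)"
      unfolding t hom_poly_degree_eq[OF n_def[symmetric]] by (simp only: distrib_left add.assoc add.right_inverse add_0_right)
    moreover have "reducible P k (t j)" if "j < n" for j
      unfolding t_def
    proof (rule less.hyps)
      show "mon_deg (m' + (Poly_Mapping.single i j + Poly_Mapping.single 3 (n - j))) = k"
        using less.prems that unfolding m by simp
      show "Poly_Mapping.lookup (m' + (Poly_Mapping.single i j + Poly_Mapping.single 3 (n - j))) 1 +
          Poly_Mapping.lookup (m' + (Poly_Mapping.single i j + Poly_Mapping.single 3 (n - j))) 2
        < Poly_Mapping.lookup m 1 + Poly_Mapping.lookup m 2"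
        using i(1) that unfolding m by (auto simp: lookup_add lookup_single)
    qed
    ultimately show ?thesis
      using i(1) by (auto intro!: reducible_add reducible_sum reducible_mult simp: n_def)
  qed
qed

lemma reducible_homog_comp:
  assumes "P \<noteq> 0" "p \<in> homog_comp k"
  shows "reducible P k p"
proof -
  have "reducible P k (\<Sum>m\<in>Poly_Mapping.keys p. Poly_Mapping.single m (Poly_Mapping.lookup p m))"
    using assms by (intro reducible_sum reducible_single) (auto simp: homog_comp_def)
  then show ?thesis by (simp only: poly_mapping_expand)
qed

text \<open>Bounding the degree through coefficients keeps the case of an empty \<open>R\<close>
  meaningful: all coefficients are then zero.\<close>

lemma poly_eq_0_of_roots:
  fixes A :: "complex poly"
  assumes "finite R" "\<And>x. x \<in> R \<Longrightarrow> poly A x = 0" "\<And>j. j \<ge> card R \<Longrightarrow> coeff A j = 0"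
  shows "A = 0"
proof (rule ccontr)
  assume "A \<noteq> 0"
  have "card R \<le> card {x. poly A x = 0}"
    by (rule card_mono) (use assms(2) poly_roots_finite[OF \<open>A \<noteq> 0\<close>] in auto)
  also have "\<dots> \<le> degree A" by (rule card_poly_roots_bound[OF \<open>A \<noteq> 0\<close>])
  finally show False using assms(3)[of "degree A"] \<open>A \<noteq> 0\<close> by simp
qed

lemma eval3_affine:
  "eval3 p (vector [x, y, 1]) = (\<Sum>m\<in>Poly_Mapping.keys p.
     Poly_Mapping.lookup p m * x ^ Poly_Mapping.lookup m 1 * y ^ Poly_Mapping.lookup m 2)"
proof -
  have "(\<Prod>i\<in>UNIV. f i) = f 1 * f 2 * f 3" for f :: "3 \<Rightarrow> complex"
    unfolding UNIV_3 by (simp add: mult.assoc)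
  then show ?thesis
    unfolding eval3_def by (simp only: vector_3 power_one mult_1_right mult.assoc)
qed

text \<open>The one-variable root count is used twice: first in x for each fixed y in
  \<open>R\<close>, then in y for each coefficient of a power of x.\<close>

lemma homog_eq_0_of_grid:
  assumes "finite R" "r \<in> homog_comp k"
    and small: "\<And>m. m \<in> Poly_Mapping.keys r \<Longrightarrow> Poly_Mapping.lookup m 1 < card R \<and> Poly_Mapping.lookup m 2 < card R"
    and zero: "\<And>x y. x \<in> R \<Longrightarrow> y \<in> R \<Longrightarrow> eval3 r (vector [x, y, 1]) = 0"
  shows "r = 0"
proof -
  let ?c = "Poly_Mapping.lookup r" and ?l = "Poly_Mapping.lookup :: (3 \<Rightarrow>\<^sub>0 nat) \<Rightarrow> 3 \<Rightarrow> nat"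
  \<comment> \<open>\<open>A y\<close> restricts \<open>r\<close> to a horizontal line of the chart
    z = 1, as a polynomial in x; \<open>B i\<close> is its coefficient of x^i, as a polynomial in
    y.\<close>
  define A where "A y = (\<Sum>m\<in>Poly_Mapping.keys r. monom (?c m * y ^ ?l m 2) (?l m 1))" for y
  define B where "B i = (\<Sum>m\<in>Poly_Mapping.keys r. if ?l m 1 = i then monom (?c m) (?l m 2) else 0)" for i
  have A: "A y = 0" if "y \<in> R" for y
  proof (rule poly_eq_0_of_roots[OF assms(1)])
    show "poly (A y) x = 0" if "x \<in> R" for x
      using zero[OF that \<open>y \<in> R\<close>] by (simp add: A_def eval3_affine poly_sum poly_monom algebra_simps)
    show "coeff (A y) j = 0" if "j \<ge> card R" for j
      unfolding A_def coeff_sum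
    proof (intro sum.neutral ballI)
      show "coeff (monom (?c m * y ^ ?l m 2) (?l m 1)) j = 0" if "m \<in> Poly_Mapping.keys r" for m
        using small[OF that] \<open>j \<ge> card R\<close> by simp
    qed
  qed
  have B: "B i = 0" for i
  proof (rule poly_eq_0_of_roots[OF assms(1)])
    show "poly (B i) y = 0" if "y \<in> R" for y
    proof -
      have "poly (B i) y = coeff (A y) i"
        unfolding A_def B_def poly_sum coeff_sum by (intro sum.cong) (auto simp: poly_monom)
      then show ?thesis using A[OF that] by simp
    qed
    show "coeff (B i) j = 0" if "j \<ge> card R" for j
      unfolding B_def coeff_sum
    proof (intro sum.neutral ballI)
      show "coeff (if ?l m 1 = i then monom (?c m) (?l m 2) else 0) j = 0"
        if "m \<in> Poly_Mapping.keys r" for m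
        using small[OF that] \<open>j \<ge> card R\<close> by simp
    qed
  qed
  have c0: "?c m = 0" if m: "m \<in> Poly_Mapping.keys r" for m
  proof -
    \<comment> \<open>Setting z = 1 does not merge monomials of \<open>r\<close>, because the degree
      \<open>k\<close> and the exponents of x and y determine the exponent of z.\<close>
    have uniq: "m' = m" if "m' \<in> Poly_Mapping.keys r" "?l m' 1 = ?l m 1" "?l m' 2 = ?l m 2" for m'
    proof (rule poly_mapping_eqI)
      have "mon_deg m' = mon_deg m" using that(1) m assms(2) by (simp add: homog_comp_def)
      then have "?l m' 3 = ?l m 3" using that by (simp add: mon_deg_def sum_3)
      then show "?l m' i = ?l m i" for i using that exhaust_3[of i] by auto
    qed
    have "0 = coeff (B (?l m 1)) (?l m 2)" using B by simp
    also have "\<dots> = (\<Sum>m'\<in>Poly_Mapping.keys r. if m' = m then ?c m else 0)"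
      unfolding B_def coeff_sum
    proof (intro sum.cong refl)
      show "coeff (if ?l m' 1 = ?l m 1 then monom (?c m') (?l m' 2) else 0) (?l m 2) = (if m' = m then ?c m else 0)"
        if "m' \<in> Poly_Mapping.keys r" for m'
        using uniq[OF that] by (cases "m' = m") auto
    qed
    also have "\<dots> = ?c m" using m by simp
    finally show ?thesis by simp
  qed
  show ?thesis
  proof (rule poly_mapping_eqI)
    show "?c m = Poly_Mapping.lookup 0 m" for m
      using c0[of m] by (cases "m \<in> Poly_Mapping.keys r") (simp_all add: in_keys_iff)
  qed
qed

text \<open>Both forms vanish on the grid of roots of \<open>P\<close>, so the remainder of the
  division vanishes there too and must be zero.\<close>

lemma vanishing_on_grid:
  assumes "P \<noteq> 0" "finite R" "card R = degree P" "\<And>x. x \<in> R \<Longrightarrow> poly P x = 0" "p \<in> homog_comp k"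
    and zero: "\<And>x y. x \<in> R \<Longrightarrow> y \<in> R \<Longrightarrow> eval3 p (vector [x, y, 1]) = 0"
  obtains u v where "p = u * hom_poly 1 (degree P) P + v * hom_poly 2 (degree P) P"
proof -
  obtain u v r where r: "p = u * hom_poly 1 (degree P) P + v * hom_poly 2 (degree P) P + r" "r \<in> homog_comp k"
     "\<forall>m\<in>Poly_Mapping.keys r. Poly_Mapping.lookup m 1 < degree P \<and> Poly_Mapping.lookup m 2 < degree P"
    using reducible_homog_comp[OF assms(1,5)] unfolding reducible_def by blast
  have "r = 0"
  proof (rule homog_eq_0_of_grid[OF assms(2) r(2)])
    show "eval3 r (vector [x, y, 1]) = 0" if "x \<in> R" "y \<in> R" for x y
      using zero[OF that] that by (simp add: r(1) eval3_hom_poly_affine assms(4))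
  qed (use r(3) assms(3) in auto)
  with r(1) show thesis by (intro that[of u v]) simp
qed

section \<open>The Milnor algebra in a fixed degree\<close>

lemma poly3_ring_simps [simp]:
  "carrier poly3_ring = UNIV" "x \<otimes>\<^bsub>poly3_ring\<^esub> y = x * y" "x \<oplus>\<^bsub>poly3_ring\<^esub> y = x + y"
  "\<zero>\<^bsub>poly3_ring\<^esub> = 0" "\<one>\<^bsub>poly3_ring\<^esub> = 1"
  by (simp_all add: poly3_ring_def ring_of_type_algebra_def)

lemma cring_poly3_ring: "cring poly3_ring"
  unfolding poly3_ring_def by (rule cring_from_type_algebra)

lemma ring_poly3_ring: "ring poly3_ring"
  by (rule cring.axioms(1)[OF cring_poly3_ring])

lemma ideal_jacobian_ideal: "ideal (jacobian_ideal f) poly3_ring"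
  unfolding jacobian_ideal_def by (rule ring.genideal_ideal[OF ring_poly3_ring]) simp

lemma jacobian_ideal_add: "p \<in> jacobian_ideal f \<Longrightarrow> q \<in> jacobian_ideal f \<Longrightarrow> p + q \<in> jacobian_ideal f"
  using additive_subgroup.a_closed[OF ideal.axioms(1)[OF ideal_jacobian_ideal]] by fastforce

lemma jacobian_ideal_mult: "p \<in> jacobian_ideal f \<Longrightarrow> q * p \<in> jacobian_ideal f"
  using ideal.I_l_closed[OF ideal_jacobian_ideal] by fastforce

lemma jacobian_ideal_zero: "0 \<in> jacobian_ideal f"
  using additive_subgroup.zero_closed[OF ideal.axioms(1)[OF ideal_jacobian_ideal]] by fastforce

lemma jacobian_ideal_diff: "p \<in> jacobian_ideal f \<Longrightarrow> q \<in> jacobian_ideal f \<Longrightarrow> p - q \<in> jacobian_ideal f"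
  using jacobian_ideal_add[of p f "(-1) * q"] jacobian_ideal_mult[of q f "-1"] by simp

lemma pd_in_jacobian_ideal: "pd i f \<in> jacobian_ideal f"
  using ring.genideal_self[OF ring_poly3_ring, of "{pd 1 f, pd 2 f, pd 3 f}"] exhaust_3[of i]
  unfolding jacobian_ideal_def by auto

text \<open>The polynomials vanishing at \<open>v\<close> form an ideal containing the three
  generators. Hence evaluation at a common zero of the partial derivatives depends only on the
  Milnor class.\<close>

lemma eval3_jacobian_ideal:
  assumes "p \<in> jacobian_ideal f" "\<And>i. eval3 (pd i f) v = 0"
  shows "eval3 p v = 0"
proof -
  interpret R: ring poly3_ring by (rule ring_poly3_ring)
  have uminus: "\<ominus>\<^bsub>poly3_ring\<^esub> x = - x" for x
    by (rule R.minus_equality) auto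
  have "ideal {p. eval3 p v = 0} poly3_ring"
  proof (rule idealI[OF ring_poly3_ring])
    show "subgroup {p. eval3 p v = 0} (add_monoid poly3_ring)"
    proof (rule R.add.subgroupI)
      have "0 \<in> {p. eval3 p v = 0}" by simp
      then show "{p. eval3 p v = 0} \<noteq> {}" by blast
      show "\<ominus>\<^bsub>poly3_ring\<^esub> a \<in> {p. eval3 p v = 0}" if "a \<in> {p. eval3 p v = 0}" for a
        using that eval3_minus[of 0 a v] by (simp add: uminus)
    qed auto
  qed auto
  from R.genideal_minimal[OF this, of "{pd 1 f, pd 2 f, pd 3 f}"] assms show ?thesis
    unfolding jacobian_ideal_def by auto
qed

lemma ring_milnor_algebra: "ring (milnor_algebra f)"
  unfolding milnor_algebra_def by (rule ideal.quotient_is_ring[OF ideal_jacobian_ideal])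

lemma milnor_class_hom: "milnor_class f \<in> ring_hom poly3_ring (milnor_algebra f)"
  unfolding milnor_algebra_def milnor_class_def
  using ideal.rcos_ring_hom[OF ideal_jacobian_ideal] by (simp add: eta_contract_eq)

lemma milnor_class_add: "milnor_class f p \<oplus>\<^bsub>milnor_algebra f\<^esub> milnor_class f q = milnor_class f (p + q)"
  using ring_hom_add[OF milnor_class_hom, of p q] by simp

lemma milnor_class_mult: "milnor_class f p \<otimes>\<^bsub>milnor_algebra f\<^esub> milnor_class f q = milnor_class f (p * q)"
  using ring_hom_mult[OF milnor_class_hom, of p q] by simp

lemma milnor_class_carrier: "milnor_class f p \<in> carrier (milnor_algebra f)"
  using ring_hom_closed[OF milnor_class_hom, of p] by simp

lemma milnor_class_eq_iff: "milnor_class f p = milnor_class f q \<longleftrightarrow> p - q \<in> jacobian_ideal f"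
proof -
  have cosets: "milnor_class f p = (\<lambda>h. h + p) ` jacobian_ideal f" for p
    by (auto simp: milnor_class_def a_r_coset_def')
  show ?thesis
  proof
    assume "milnor_class f p = milnor_class f q"
    then have "0 + p \<in> (\<lambda>h. h + q) ` jacobian_ideal f"
      using jacobian_ideal_zero[of f] by (metis cosets image_eqI)
    then show "p - q \<in> jacobian_ideal f" by auto
  next
    assume *: "p - q \<in> jacobian_ideal f"
    show "milnor_class f p = milnor_class f q"
      unfolding cosets
    proof (intro equalityI image_subsetI)
      show "h + p \<in> (\<lambda>h. h + q) ` jacobian_ideal f" if "h \<in> jacobian_ideal f" for h
        by (rule image_eqI[where x = "h + (p - q)"]) (use jacobian_ideal_add[OF that *] in auto)
      show "h + q \<in> (\<lambda>h. h + p) ` jacobian_ideal f" if "h \<in> jacobian_ideal f" for h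
        by (rule image_eqI[where x = "h - (p - q)"]) (use jacobian_ideal_diff[OF that *] in auto)
    qed
  qed
qed

lemma milnor_class_zero: "milnor_class f 0 = \<zero>\<^bsub>milnor_algebra f\<^esub>"
  using ring_hom_zero[OF milnor_class_hom ring_poly3_ring ring_milnor_algebra] by simp

text \<open>If evaluation at the points of \<open>N\<close> identifies the degree \<open>k\<close> part of the Milnor algebra
  with the functions on \<open>N\<close>, a flag is obtained by adding the points one at a time.\<close>

lemma milnor_comp_has_dim_evaluation:
  assumes "finite N"
    and vanish: "\<And>s i. s \<in> N \<Longrightarrow> eval3 (pd i f) (pt s) = 0"
    and inj: "\<And>p. p \<in> homog_comp k \<Longrightarrow> (\<And>s. s \<in> N \<Longrightarrow> eval3 p (pt s) = 0) \<Longrightarrow> p \<in> jacobian_ideal f"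
    and surj: "\<And>s. s \<in> N \<Longrightarrow> \<exists>L\<in>homog_comp k. \<forall>t\<in>N. eval3 L (pt t) = (if t = s then 1 else 0)"
  shows "milnor_comp_has_dim f k (card N)"
proof -
  interpret M: ring "milnor_algebra f" by (rule ring_milnor_algebra)
  \<comment> \<open>The flag consists of the images of the \<open>E A\<close>: by \<open>inj\<close>
    the image is zero for empty \<open>A\<close>, and for \<open>A = N\<close> it is the whole
    degree \<open>k\<close> part.\<close>
  define E where "E A = {p \<in> homog_comp k. \<forall>t\<in>N - A. eval3 p (pt t) = 0}" for A
  have "M.dimension (card A) (milnor_scalars f) (milnor_class f ` E A)" if "finite A" "A \<subseteq> N" for A
    using that
  proof (induction A rule: finite_induct)
    case empty
    have "milnor_class f p = \<zero>\<^bsub>milnor_algebra f\<^esub>" if "p \<in> E {}" for p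
      using that inj[of p] milnor_class_eq_iff[of f p 0] by (simp add: E_def milnor_class_zero)
    moreover have "0 \<in> E {}" by (simp add: E_def)
    ultimately have "milnor_class f ` E {} = {\<zero>\<^bsub>milnor_algebra f\<^esub>}" by blast
    then show ?case by simp
  next
    case (insert a A)
    then have a: "a \<in> N" by simp
    obtain L where L: "L \<in> homog_comp k" "\<And>t. t \<in> N \<Longrightarrow> eval3 L (pt t) = (if t = a then 1 else 0)"
      using surj[OF a] by blast
    \<comment> \<open>Evaluation at the new point is 1 on \<open>L\<close> and 0 on
      \<open>E A\<close>, and it is well defined on classes.\<close>
    have notin: "milnor_class f L \<notin> milnor_class f ` E A"
    proof
      assume "milnor_class f L \<in> milnor_class f ` E A"
      then obtain p where p: "p \<in> E A" "milnor_class f L = milnor_class f p" by blast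
      then have "L - p \<in> jacobian_ideal f" by (simp add: milnor_class_eq_iff)
      from eval3_jacobian_ideal[OF this vanish[OF a]] show False
        using L(2)[OF a] p(1) a insert.hyps(2) by (simp add: E_def)
    qed
    have "M.line_extension (milnor_scalars f) (milnor_class f L) (milnor_class f ` E A) =
        {milnor_class f (Const c * L + p) |c p. p \<in> E A}"
      unfolding M.line_extension_def set_add_def' r_coset_def milnor_scalars_def
      by (auto simp: milnor_class_mult milnor_class_add) 
    also have "\<dots> = milnor_class f ` E (insert a A)"
    proof (intro equalityI subsetI)
      fix y assume "y \<in> {milnor_class f (Const c * L + p) |c p. p \<in> E A}"
      then obtain c p where y: "y = milnor_class f (Const c * L + p)" "p \<in> E A" by blast
      have "Const c * L + p \<in> E (insert a A)"
        using y(2) L by (auto simp: E_def homog_comp_add homog_comp_Const_mult)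
      then show "y \<in> milnor_class f ` E (insert a A)" using y by blast
    next
      fix y assume "y \<in> milnor_class f ` E (insert a A)"
      then obtain q where q: "y = milnor_class f q" "q \<in> E (insert a A)" by blast
      \<comment> \<open>Subtracting \<open>c\<close> times \<open>L\<close> kills the value at the
        new point and changes no value at the other points of \<open>N\<close>.\<close>
      define c where "c = eval3 q (pt a)"
      have "q - Const c * L \<in> E A"
        using q(2) L by (auto simp: E_def c_def homog_comp_minus homog_comp_Const_mult)
      moreover have "y = milnor_class f (Const c * L + (q - Const c * L))" using q by simp
      ultimately show "y \<in> {milnor_class f (Const c * L + p) |c p. p \<in> E A}" by blast
    qed
    finally show ?case
      using M.Suc_dim[OF milnor_class_carrier notin insert.IH] insert by simp
  qed
  from this[OF assms(1) order_refl] show ?thesis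
    by (simp add: milnor_comp_has_dim_def milnor_comp_def E_def)
qed

section \<open>Nodes of separated equations\<close>

text \<open>At a simple critical point a polynomial is, up to its critical value, the square of a local
  coordinate.\<close>

lemma simple_critical_point_square:
  fixes q :: "complex poly"
  assumes "poly (pderiv q) a = 0" "poly (pderiv (pderiv q)) a \<noteq> 0"
  obtains U \<phi> \<psi> where "open U" "a \<in> U" "\<phi> holomorphic_on U" "\<phi> a = 0" "open (\<phi> ` U)"
    "\<psi> holomorphic_on \<phi> ` U" "\<And>z. z \<in> U \<Longrightarrow> \<psi> (\<phi> z) = z"
    "\<And>z. z \<in> U \<Longrightarrow> poly q z = poly q a + (\<phi> z)\<^sup>2"
proof -
  \<comment> \<open>Two divisions by z - a give q(z) = q(a) + (z - a)^2 h(z) with 2 h(a) = q''(a),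
    hence h(a) is nonzero.\<close>
  have "poly (q - [:poly q a:]) a = 0" by simp
  then obtain g where g: "q - [:poly q a:] = [:- a, 1:] * g"
    unfolding poly_eq_0_iff_dvd by (elim dvdE)
  have pd1: "pderiv q = g + [:- a, 1:] * pderiv g"
    using arg_cong[OF g, of pderiv] by (simp add: pderiv_diff pderiv_mult pderiv_pCons pderiv_smult algebra_simps)
  then have "poly g a = 0" using assms(1) by simp
  then obtain h where h: "g = [:- a, 1:] * h"
    unfolding poly_eq_0_iff_dvd by (elim dvdE)
  have "poly (pderiv (pderiv q)) a = 2 * poly h a"
    unfolding pd1 h by (simp add: pderiv_add pderiv_diff pderiv_smult pderiv_pCons)
  then have ha: "poly h a \<noteq> 0" using assms(2) by simp
  have q: "poly q z = poly q a + (z - a)\<^sup>2 * poly h z" for z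
    using arg_cong[OF g, of "\<lambda>p. poly p z"] by (simp add: h power2_eq_square algebra_simps)
  have "open {z. poly h z \<noteq> 0}"
    by (intro open_Collect_neq continuous_intros)
  then obtain r where r: "r > 0" "ball a r \<subseteq> {z. poly h z \<noteq> 0}"
    using ha by (metis mem_Collect_eq openE)
  have "poly h holomorphic_on ball a r"
    unfolding holomorphic_on_def
    by (meson DERIV_subset field_differentiable_def poly_DERIV subset_UNIV)
  then obtain l where l: "l holomorphic_on ball a r" "\<And>z. z \<in> ball a r \<Longrightarrow> exp (l z) = poly h z"
    by (rule holomorphic_logarithm_exists[OF convex_ball open_ball, of "poly h" a r a])
      (use r in auto)
  \<comment> \<open>A branch of (z - a) sqrt(h), the square root coming from a logarithm of h on a
    disc free of zeros of h. Its derivative at a is exp(l(a) / 2), which is nonzero, so it is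
    injective near a.\<close>
  define \<phi> where "\<phi> z = (z - a) * exp (l z / 2)" for z
  have hol: "\<phi> holomorphic_on ball a r"
    unfolding \<phi>_def by (intro holomorphic_intros l(1)) auto
  have "(l has_field_derivative deriv l a) (at a)"
    using r(1) by (intro holomorphic_derivI[OF l(1)]) auto
  then have "(\<phi> has_field_derivative exp (l a / 2)) (at a)"
    unfolding \<phi>_def by (auto intro!: derivative_eq_intros)
  then have "deriv \<phi> a \<noteq> 0" by (simp add: DERIV_imp_deriv)
  then obtain s where s: "s > 0" "ball a s \<subseteq> ball a r" "inj_on \<phi> (ball a s)"
    using has_complex_derivative_locally_injective[OF hol, of a] r(1) by auto
  have hol': "\<phi> holomorphic_on ball a s" by (rule holomorphic_on_subset[OF hol s(2)])
  obtain \<psi> where \<psi>: "\<psi> holomorphic_on \<phi> ` ball a s" "\<And>z. z \<in> ball a s \<Longrightarrow> \<psi> (\<phi> z) = z"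
    using holomorphic_has_inverse[OF hol' open_ball s(3)] by metis
  show thesis
  proof (rule that[OF _ _ hol' _ _ \<psi>])
    show "open (\<phi> ` ball a s)" by (rule open_mapping_thm3[OF hol' open_ball s(3)])
    fix z assume "z \<in> ball a s"
    then have "exp (l z) = poly h z" using l(2) s(2) by blast
    then have "poly h z = (exp (l z / 2))\<^sup>2" by (simp flip: exp_double)
    then show "poly q z = poly q a + (\<phi> z)\<^sup>2" by (simp add: q[of z] \<phi>_def power_mult_distrib)
  qed (use s(1) in \<open>auto simp: \<phi>_def\<close>)
qed

text \<open>The summands are compositions with the linear maps \<open>axis 1\<close> and
  \<open>axis 2\<close>, so the differentiation rules apply to each of them.\<close>

definition map_coords :: "(complex \<Rightarrow> complex) \<Rightarrow> (complex \<Rightarrow> complex) \<Rightarrow> complex ^ 2 \<Rightarrow> complex ^ 2" where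
  "map_coords f g w = axis 1 (f (w $ 1)) + axis 2 (g (w $ 2))"

lemma map_coords_nth [simp]: "map_coords f g w $ 1 = f (w $ 1)" "map_coords f g w $ 2 = g (w $ 2)"
  by (simp_all add: map_coords_def axis_def)

definition box2 :: "complex set \<Rightarrow> complex set \<Rightarrow> (complex ^ 2) set" where
  "box2 S T = {w. w $ 1 \<in> S \<and> w $ 2 \<in> T}"

lemma open_box2: "open S \<Longrightarrow> open T \<Longrightarrow> open (box2 S T)"
  unfolding box2_def
  using open_Int[OF open_vimage_vec_nth[of S 1] open_vimage_vec_nth[of T 2]] by (simp add: vimage_def Int_def)

lemma bounded_linear_axis: "bounded_linear (axis i :: complex \<Rightarrow> complex ^ 2)"
  by (rule linear_conv_bounded_linear[THEN iffD1], rule linearI) (auto simp: axis_def vec_eq_iff)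

lemma holomorphic2_on_map_coords:
  assumes "f holomorphic_on S" "g holomorphic_on T" "open S" "open T"
  shows "holomorphic2_on (map_coords f g) (box2 S T)"
  unfolding holomorphic2_on_def
proof (intro conjI ballI open_box2 assms)
  fix w assume w: "w \<in> box2 S T"
  have f: "(f has_derivative (*) (deriv f (w $ 1))) (at (w $ 1))"
    using holomorphic_derivI[OF assms(1,3), of "w $ 1"] w by (auto simp: box2_def has_field_derivative_def)
  have g: "(g has_derivative (*) (deriv g (w $ 2))) (at (w $ 2))"
    using holomorphic_derivI[OF assms(2,4), of "w $ 2"] w by (auto simp: box2_def has_field_derivative_def)
  have nth: "((\<lambda>w. w $ i) has_derivative (\<lambda>w. w $ i)) (at w)" for i
    by (rule bounded_linear_imp_has_derivative) (rule bounded_linear_vec_nth)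
  have "(map_coords f g has_derivative (\<lambda>h. axis 1 (deriv f (w $ 1) * h $ 1) + axis 2 (deriv g (w $ 2) * h $ 2))) (at w)"
    unfolding map_coords_def
    by (intro has_derivative_add bounded_linear.has_derivative[OF bounded_linear_axis]
        has_derivative_compose[OF nth f] has_derivative_compose[OF nth g])
  \<comment> \<open>Each component depends on one coordinate only, so the Jacobian matrix is
    diagonal.\<close>
  moreover have "(\<lambda>h :: complex ^ 2. axis 1 (deriv f (w $ 1) * h $ 1) + axis 2 (deriv g (w $ 2) * h $ 2)) =
      (\<lambda>h. (vector [vector [deriv f (w $ 1), 0], vector [0, deriv g (w $ 2)]] :: complex ^ 2 ^ 2) *v h)"
    by (auto simp: fun_eq_iff vec_eq_iff matrix_vector_mult_def sum_2 forall_2 axis_def)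
  ultimately show "\<exists>A. (map_coords f g has_derivative (\<lambda>h. A *v h)) (at w)" by metis
qed

lemma holomorphic2_on_imp_continuous_on: "holomorphic2_on f U \<Longrightarrow> continuous_on U f"
  unfolding holomorphic2_on_def
  by (auto intro!: continuous_at_imp_continuous_on dest!: bspec has_derivative_continuous)

text \<open>The local square roots of \<open>q1\<close> and \<open>q2\<close> minus their critical
  values together form coordinates of the plane; the critical values cancel by
  \<open>zero\<close>.\<close>

lemma A1_at_separated:
  assumes q: "poly (pderiv q1) (p $ 1) = 0" "poly (pderiv (pderiv q1)) (p $ 1) \<noteq> 0"
      "poly (pderiv q2) (p $ 2) = 0" "poly (pderiv (pderiv q2)) (p $ 2) \<noteq> 0"
    and zero: "poly q1 (p $ 1) + poly q2 (p $ 2) = 0"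
  shows "A1_at (\<lambda>w. poly q1 (w $ 1) + poly q2 (w $ 2)) p"
proof -
  obtain U \<phi> \<psi> where 1: "open U" "p $ 1 \<in> U" "\<phi> holomorphic_on U" "\<phi> (p $ 1) = 0" "open (\<phi> ` U)"
    "\<psi> holomorphic_on \<phi> ` U" "\<And>z. z \<in> U \<Longrightarrow> \<psi> (\<phi> z) = z"
    "\<And>z. z \<in> U \<Longrightarrow> poly q1 z = poly q1 (p $ 1) + (\<phi> z)\<^sup>2"
    using simple_critical_point_square[OF q(1,2)] by metis
  obtain V \<theta> \<eta> where 2: "open V" "p $ 2 \<in> V" "\<theta> holomorphic_on V" "\<theta> (p $ 2) = 0" "open (\<theta> ` V)"
    "\<eta> holomorphic_on \<theta> ` V" "\<And>z. z \<in> V \<Longrightarrow> \<eta> (\<theta> z) = z"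
    "\<And>z. z \<in> V \<Longrightarrow> poly q2 z = poly q2 (p $ 2) + (\<theta> z)\<^sup>2"
    using simple_critical_point_square[OF q(3,4)] by metis
  have hol: "holomorphic2_on (map_coords \<phi> \<theta>) (box2 U V)"
      "holomorphic2_on (map_coords \<psi> \<eta>) (box2 (\<phi> ` U) (\<theta> ` V))"
    using 1 2 by (auto intro!: holomorphic2_on_map_coords)
  have "homeomorphism (box2 U V) (box2 (\<phi> ` U) (\<theta> ` V)) (map_coords \<phi> \<theta>) (map_coords \<psi> \<eta>)"
    using hol[THEN holomorphic2_on_imp_continuous_on]
    by (intro homeomorphismI) (auto simp: box2_def 1(7) 2(7) vec_eq_iff forall_2)
  moreover have "poly q1 (w $ 1) + poly q2 (w $ 2) = (map_coords \<phi> \<theta> w $ 1)\<^sup>2 + (map_coords \<phi> \<theta> w $ 2)\<^sup>2"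
    if "w \<in> box2 U V" for w
  proof -
    have "poly q1 (w $ 1) + poly q2 (w $ 2) = (poly q1 (p $ 1) + poly q2 (p $ 2)) + (\<phi> (w $ 1))\<^sup>2 + (\<theta> (w $ 2))\<^sup>2"
      using that by (simp add: box2_def 1(8)[of "w $ 1"] 2(8)[of "w $ 2"])
    then show ?thesis by (simp add: zero)
  qed
  moreover have "p \<in> box2 U V" "map_coords \<phi> \<theta> p = 0"
    using 1 2 by (auto simp: box2_def vec_eq_iff forall_2)
  ultimately show ?thesis
    unfolding A1_at_def using hol by blast
qed

section \<open>The singular points of the Chebyshev curve\<close>

definition grid_point :: "nat \<Rightarrow> nat \<times> nat \<Rightarrow> complex ^ 3" where
  "grid_point d = (\<lambda>(i, j). vector [cheb_crit d i, cheb_crit d j, 1])"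

lemma grid_point_nth [simp]:
  "grid_point d s $ 1 = cheb_crit d (fst s)" "grid_point d s $ 2 = cheb_crit d (snd s)"
  "grid_point d s $ 3 = 1"
  by (simp_all add: grid_point_def split_beta)

definition odd_grid :: "nat \<Rightarrow> (nat \<times> nat) set" where
  "odd_grid n = {(i, j) \<in> {1..n} \<times> {1..n}. odd (i + j)}"

lemma finite_odd_grid [simp]: "finite (odd_grid n)"
  by (rule finite_subset[of _ "{1..n} \<times> {1..n}"]) (auto simp: odd_grid_def)

text \<open>The z-derivative of the form of T_(n+1) at z = 1, as computed in
  \<open>pd_3_hom_poly\<close>.\<close>

definition cheb_z_part :: "nat \<Rightarrow> complex poly" where
  "cheb_z_part n = smult (of_nat (Suc n)) (ccheb (Suc n)) - pCons 0 (pderiv (ccheb (Suc n)))"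

lemma pd_cheb_form:
  "pd 1 (cheb_form (Suc n)) = hom_poly 1 n (pderiv (ccheb (Suc n)))"
  "pd 2 (cheb_form (Suc n)) = hom_poly 2 n (pderiv (ccheb (Suc n)))"
  "pd 3 (cheb_form (Suc n)) = hom_poly 1 n (cheb_z_part n) + hom_poly 2 n (cheb_z_part n)"
  by (simp_all add: cheb_form_eq pd_add pd_hom_poly_self pd_hom_poly_other pd_3_hom_poly cheb_z_part_def
      del: of_nat_Suc)

text \<open>The coefficients of degree n + 1 in (n + 1) T and in x T' agree and cancel.\<close>

lemma degree_cheb_z_part: "degree (cheb_z_part n) \<le> n"
proof (rule degree_le, intro allI impI)
  fix j assume "n < j"
  then obtain l where j: "j = Suc l" "n \<le> l" by (cases j) auto
  show "coeff (cheb_z_part n) j = 0"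
    using j by (cases "l = n") (auto simp: cheb_z_part_def coeff_pderiv coeff_eq_0 simp del: of_nat_Suc)
qed

lemma poly_cheb_z_part_crit:
  assumes "i \<in> {1..n}"
  shows "poly (cheb_z_part n) (cheb_crit (Suc n) i) = of_nat (Suc n) * (-1) ^ i"
  using poly_ccheb_crit[OF assms] poly_pderiv_ccheb_crit[OF assms]
  by (simp add: cheb_z_part_def del: of_nat_Suc)

lemma eval3_pd_grid_point:
  assumes "s \<in> {1..n} \<times> {1..n}"
  shows "eval3 (pd 1 (cheb_form (Suc n))) (grid_point (Suc n) s) = 0"
    "eval3 (pd 2 (cheb_form (Suc n))) (grid_point (Suc n) s) = 0"
    "eval3 (pd 3 (cheb_form (Suc n))) (grid_point (Suc n) s) =
      of_nat (Suc n) * ((-1) ^ fst s + (-1) ^ snd s)"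
proof -
  have *: "fst s \<in> {1..n}" "snd s \<in> {1..n}" using assms by auto
  show "eval3 (pd 1 (cheb_form (Suc n))) (grid_point (Suc n) s) = 0"
    "eval3 (pd 2 (cheb_form (Suc n))) (grid_point (Suc n) s) = 0"
    "eval3 (pd 3 (cheb_form (Suc n))) (grid_point (Suc n) s) =
      of_nat (Suc n) * ((-1) ^ fst s + (-1) ^ snd s)"
    by (simp_all add: pd_cheb_form eval3_hom_poly_affine degree_cheb_z_part
        poly_pderiv_ccheb_crit[OF *(1)] poly_pderiv_ccheb_crit[OF *(2)]
        poly_cheb_z_part_crit[OF *(1)] poly_cheb_z_part_crit[OF *(2)] distrib_left del: of_nat_Suc)
qed

lemma minus_one_power_add_eq_0_iff: "(-1) ^ i + (-1) ^ j = (0::complex) \<longleftrightarrow> odd (i + j)"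
  by (auto simp: minus_one_power_iff)

lemma eval3_pd_odd_grid:
  assumes "s \<in> odd_grid n"
  shows "eval3 (pd i (cheb_form (Suc n))) (grid_point (Suc n) s) = 0"
proof -
  have s: "s \<in> {1..n} \<times> {1..n}" "odd (fst s + snd s)"
    using assms by (auto simp: odd_grid_def)
  then have "(-1) ^ fst s + (-1) ^ snd s = (0::complex)"
    by (simp add: minus_one_power_add_eq_0_iff)
  then show ?thesis
    using exhaust_3[of i] eval3_pd_grid_point[OF s(1)] by auto
qed

section \<open>Interpolation on the grid\<close>

definition crit_lagrange :: "nat \<Rightarrow> nat \<Rightarrow> complex poly" where
  "crit_lagrange n i = (\<Prod>l\<in>{1..n} - {i}.
     smult (1 / (cheb_crit (Suc n) i - cheb_crit (Suc n) l)) [:- cheb_crit (Suc n) l, 1:])"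

lemma degree_crit_lagrange:
  assumes "i \<in> {1..n}"
  shows "degree (crit_lagrange n i) \<le> n - 1"
proof -
  have "degree (crit_lagrange n i) \<le> (\<Sum>l\<in>{1..n} - {i}. degree
      (smult (1 / (cheb_crit (Suc n) i - cheb_crit (Suc n) l)) [:- cheb_crit (Suc n) l, 1:]))"
    unfolding crit_lagrange_def by (rule degree_prod_sum_le[THEN order_trans]) (auto simp: o_def)
  also have "\<dots> \<le> (\<Sum>l\<in>{1..n} - {i}. 1)"
    by (intro sum_mono) (simp add: degree_smult_le[THEN order_trans])
  also have "\<dots> = n - 1" using assms by simp
  finally show ?thesis .
qed

lemma poly_crit_lagrange:
  assumes "i \<in> {1..n}" "j \<in> {1..n}"
  shows "poly (crit_lagrange n i) (cheb_crit (Suc n) j) = (if j = i then 1 else 0)"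
proof (cases "j = i")
  case True
  have "cheb_crit (Suc n) i \<noteq> cheb_crit (Suc n) l" if "l \<in> {1..n} - {i}" for l
    using inj_onD[OF inj_on_cheb_crit, of n i l] that assms by auto
  then have "(\<Prod>l\<in>{1..n} - {i}. poly (smult (1 / (cheb_crit (Suc n) i - cheb_crit (Suc n) l))
      [:- cheb_crit (Suc n) l, 1:]) (cheb_crit (Suc n) i)) = (\<Prod>l\<in>{1..n} - {i}. 1)"
    by (intro prod.cong) (auto simp: divide_simps)
  then show ?thesis using True by (simp add: crit_lagrange_def poly_prod)
next
  case False
  then have "\<exists>l\<in>{1..n} - {i}. poly (smult (1 / (cheb_crit (Suc n) i - cheb_crit (Suc n) l))
      [:- cheb_crit (Suc n) l, 1:]) (cheb_crit (Suc n) j) = 0"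
    using assms by (intro bexI[of _ j]) auto
  then show ?thesis using False
    unfolding crit_lagrange_def poly_prod by (subst prod_zero) auto
qed

text \<open>A power of z pads the product to degree \<open>e\<close> and equals 1 at all grid
  points.\<close>

lemma hom_poly_product:
  assumes "a + b \<le> e" "degree A \<le> a" "degree B \<le> b"
  shows "\<exists>p\<in>homog_comp e. \<forall>s. eval3 p (grid_point d s) = poly A (cheb_crit d (fst s)) * poly B (cheb_crit d (snd s))"
proof (intro bexI allI)
  let ?p = "hom_poly 1 a A * hom_poly 2 b B * Var 3 ^ (e - a - b)"
  show "eval3 ?p (grid_point d s) = poly A (cheb_crit d (fst s)) * poly B (cheb_crit d (snd s))" for s
    using assms by (simp add: eval3_hom_poly_affine)
  have "?p \<in> homog_comp (a + b + (e - a - b))"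
    by (intro homog_comp_mult homog_comp_hom_poly homog_comp_Var_power)
  then show "?p \<in> homog_comp e" using assms(1) by simp
qed

text \<open>A product of two Lagrange polynomials, each of degree at most n - 1, which accounts for
  the bound 2 (n - 1).\<close>

lemma interpolation_grid:
  assumes "s \<in> {1..n} \<times> {1..n}" "k \<ge> 2 * (n - 1)"
  shows "\<exists>L\<in>homog_comp k. \<forall>t\<in>{1..n} \<times> {1..n}. eval3 L (grid_point (Suc n) t) = (if t = s then 1 else 0)"
proof -
  have s: "fst s \<in> {1..n}" "snd s \<in> {1..n}" using assms by auto
  have "n - 1 + (n - 1) \<le> k" using assms(2) by simp
  from hom_poly_product[OF this degree_crit_lagrange[OF s(1)] degree_crit_lagrange[OF s(2)]]
  obtain L where L: "L \<in> homog_comp k" "\<And>t. eval3 L (grid_point (Suc n) t) =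
      poly (crit_lagrange n (fst s)) (cheb_crit (Suc n) (fst t)) *
      poly (crit_lagrange n (snd s)) (cheb_crit (Suc n) (snd t))"
    by blast
  show ?thesis
    by (intro bexI[OF _ L(1)]) (use s in \<open>auto simp: L(2) poly_crit_lagrange prod_eq_iff\<close>)
qed

text \<open>Since \<open>U\<^bsub>n-1-a\<^esub>(x\<^sub>i) = (-1)\<^bsup>i+1\<^esup> U\<^sub>a(x\<^sub>i)\<close> at the critical points \<open>x\<^sub>i\<close> of the Chebyshev
  polynomial of degree \<open>n + 1\<close>, the products \<open>U\<^sub>a(x) U\<^sub>b(y)\<close> and \<open>U\<^bsub>n-1-a\<^esub>(x) U\<^bsub>n-1-b\<^esub>(y)\<close> agree on
  the grid points with \<open>i + j\<close> even. One of the two has degree at most \<open>n - 1\<close>.\<close>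

lemma chebU_product_even_grid:
  assumes "a < n" "b < n" "e \<ge> n - 1"
  shows "\<exists>p\<in>homog_comp e. \<forall>t\<in>{1..n} \<times> {1..n} - odd_grid n. eval3 p (grid_point (Suc n) t) =
    poly (chebU a) (cheb_crit (Suc n) (fst t)) * poly (chebU b) (cheb_crit (Suc n) (snd t))"
proof (cases "a + b \<le> n - 1")
  case True
  then have "a + b \<le> e" using assms(3) by simp
  from hom_poly_product[OF this, of "chebU a" "chebU b" "Suc n"]
  obtain p where "p \<in> homog_comp e" "\<And>t. eval3 p (grid_point (Suc n) t) =
      poly (chebU a) (cheb_crit (Suc n) (fst t)) * poly (chebU b) (cheb_crit (Suc n) (snd t))"
    by auto
  then show ?thesis by blast
next
  case False
  \<comment> \<open>The complementary indices add up to 2 (n - 1) - (a + b), which is below n - 1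
    because a + b exceeds n - 1.\<close>
  then have "(n - 1 - a) + (n - 1 - b) \<le> e" using assms by simp
  from hom_poly_product[OF this, of "chebU (n - 1 - a)" "chebU (n - 1 - b)" "Suc n"]
  obtain p where p: "p \<in> homog_comp e" "\<And>t. eval3 p (grid_point (Suc n) t) =
      poly (chebU (n - 1 - a)) (cheb_crit (Suc n) (fst t)) * poly (chebU (n - 1 - b)) (cheb_crit (Suc n) (snd t))"
    by auto
  show ?thesis
  proof (intro bexI[OF _ p(1)] ballI)
    fix t assume t: "t \<in> {1..n} \<times> {1..n} - odd_grid n"
    then have t12: "fst t \<in> {1..n}" "snd t \<in> {1..n}" and "even (fst t + snd t)"
      by (auto simp: odd_grid_def)
    \<comment> \<open>The signs of the two reflections cancel because the index sum is even.\<close>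
    then have sgn1: "(-1) ^ Suc (fst t) * (-1) ^ Suc (snd t) = (1::complex)"
      by (simp flip: power_add)
    have swap: "\<sigma> * u * (\<tau> * v) = \<sigma> * \<tau> * (u * v)" for \<sigma> \<tau> u v :: complex
      by (simp only: mult.assoc mult.left_commute)
    have cancel: "(-1) ^ Suc (fst t) * u * ((-1) ^ Suc (snd t) * v) = u * v" for u v :: complex
      unfolding swap[of "(-1) ^ Suc (fst t)" u] sgn1 by (rule mult_1)
    show "eval3 p (grid_point (Suc n) t) =
        poly (chebU a) (cheb_crit (Suc n) (fst t)) * poly (chebU b) (cheb_crit (Suc n) (snd t))"
      unfolding p(2) poly_chebU_crit_reflect[OF t12(1) assms(1)] poly_chebU_crit_reflect[OF t12(2) assms(2)]
      by (rule cancel)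
  qed
qed

text \<open>Expanding both Lagrange factors in the U_a turns their product into a combination of
  terms U_a(x) U_b(y). On the even points each term can be replaced by a form \<open>W a b\<close>
  of degree \<open>e\<close>, for any e >= n - 1, half of the bound for the whole grid.\<close>

lemma interpolation_even_grid:
  assumes "s \<in> {1..n} \<times> {1..n}" "e \<ge> n - 1"
  shows "\<exists>q\<in>homog_comp e. \<forall>t\<in>{1..n} \<times> {1..n} - odd_grid n.
    eval3 q (grid_point (Suc n) t) = (if t = s then 1 else 0)"
proof -
  have s: "fst s \<in> {1..n}" "snd s \<in> {1..n}" using assms by auto
  have "degree (crit_lagrange n i) < n \<or> crit_lagrange n i = 0" if "i \<in> {1..n}" for i
    using degree_crit_lagrange[OF that] that by auto
  note basis = chebU_basis[OF this]
  obtain \<alpha> where \<alpha>: "crit_lagrange n (fst s) = (\<Sum>a<n. smult (\<alpha> a) (chebU a))"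
    using basis[OF s(1)] by blast
  obtain \<beta> where \<beta>: "crit_lagrange n (snd s) = (\<Sum>a<n. smult (\<beta> a) (chebU a))"
    using basis[OF s(2)] by blast
  obtain W where W: "\<And>a b. a < n \<Longrightarrow> b < n \<Longrightarrow> W a b \<in> homog_comp e"
    "\<And>a b t. a < n \<Longrightarrow> b < n \<Longrightarrow> t \<in> {1..n} \<times> {1..n} - odd_grid n \<Longrightarrow> eval3 (W a b) (grid_point (Suc n) t) =
      poly (chebU a) (cheb_crit (Suc n) (fst t)) * poly (chebU b) (cheb_crit (Suc n) (snd t))"
    using chebU_product_even_grid[of _ n _ e] assms(2) by metis
  show ?thesis
  proof (intro bexI ballI)
    show "(\<Sum>a<n. \<Sum>b<n. Const (\<alpha> a * \<beta> b) * W a b) \<in> homog_comp e"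
      by (intro homog_comp_sum homog_comp_Const_mult W(1)) auto
    fix t assume t: "t \<in> {1..n} \<times> {1..n} - odd_grid n"
    have "eval3 (\<Sum>a<n. \<Sum>b<n. Const (\<alpha> a * \<beta> b) * W a b) (grid_point (Suc n) t) =
        poly (crit_lagrange n (fst s)) (cheb_crit (Suc n) (fst t)) *
        poly (crit_lagrange n (snd s)) (cheb_crit (Suc n) (snd t))"
      unfolding \<alpha> \<beta> using t
      by (simp add: eval3_sum W(2) poly_sum sum_product mult.assoc mult.left_commute)
    also have "\<dots> = (if t = s then 1 else 0)"
      using t s by (subst (1 2) poly_crit_lagrange) (auto simp: prod_eq_iff)
    finally show "eval3 (\<Sum>a<n. \<Sum>b<n. Const (\<alpha> a * \<beta> b) * W a b) (grid_point (Suc n) t) =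
        (if t = s then 1 else 0)" .
  qed
qed

section \<open>Dimension of the Milnor algebra in high degrees\<close>

lemma vanishing_on_odd_grid:
  assumes k: "k + 1 \<ge> 2 * n" and p: "p \<in> homog_comp k"
    and zero: "\<And>s. s \<in> odd_grid n \<Longrightarrow> eval3 p (grid_point (Suc n) s) = 0"
  shows "p \<in> jacobian_ideal (cheb_form (Suc n))"
proof -
  let ?f = "cheb_form (Suc n)" and ?G = "{1..n} \<times> {1..n}"
  define ev where "ev q s = eval3 q (grid_point (Suc n) s)" for q s
  have "\<forall>s\<in>?G. \<exists>q\<in>homog_comp (k - n). \<forall>t\<in>?G - odd_grid n. ev q t = (if t = s then 1 else 0)"
    unfolding ev_def using k by (intro ballI interpolation_even_grid) auto
  then obtain q where q: "\<And>s. s \<in> ?G \<Longrightarrow> q s \<in> homog_comp (k - n)"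
    "\<And>s t. s \<in> ?G \<Longrightarrow> t \<in> ?G - odd_grid n \<Longrightarrow> ev (q s) t = (if t = s then 1 else 0)"
    by metis
  \<comment> \<open>\<open>w\<close> is the multiplier of f_z: it takes the value p / f_z at every
    even point, where f_z is nonzero by the parity of the index sum.\<close>
  define w where "w = (\<Sum>s\<in>?G - odd_grid n. Const (ev p s / ev (pd 3 ?f) s) * q s)"
  have ev_w: "ev w t = ev p t / ev (pd 3 ?f) t" if "t \<in> ?G - odd_grid n" for t
  proof -
    have "ev w t = (\<Sum>s\<in>?G - odd_grid n. if s = t then ev p t / ev (pd 3 ?f) t else 0)"
      unfolding w_def ev_def eval3_sum using q(2) that
      by (intro sum.cong) (auto simp: ev_def)
    also have "\<dots> = ev p t / ev (pd 3 ?f) t" using that by (subst sum.delta) auto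
    finally show ?thesis .
  qed
  have "pd 3 ?f \<in> homog_comp n"
    unfolding pd_cheb_form by (intro homog_comp_add homog_comp_hom_poly)
  moreover have "w \<in> homog_comp (k - n)"
    unfolding w_def using q(1) by (intro homog_comp_sum homog_comp_Const_mult) auto
  \<comment> \<open>The truncated subtraction is exact: k >= 2 n - 1 >= n for positive n, and n = 0
    is trivial.\<close>
  moreover have "k - n + n = k" using k by simp
  ultimately have wk: "w * pd 3 ?f \<in> homog_comp k" using homog_comp_mult by metis
  have "ev (p - w * pd 3 ?f) t = 0" if t: "t \<in> ?G" for t
  proof (cases "t \<in> odd_grid n")
    case True
    then show ?thesis using zero eval3_pd_odd_grid by (simp add: ev_def)
  next
    case False
    then have "even (fst t + snd t)" using t by (auto simp: odd_grid_def)
    then have "ev (pd 3 ?f) t \<noteq> 0"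
      unfolding ev_def eval3_pd_grid_point(3)[OF t] minus_one_power_add_eq_0_iff mult_eq_0_iff
      by (auto simp del: of_nat_Suc)
    then show ?thesis using ev_w[of t] False t by (simp add: ev_def)
  qed
  then have grid: "eval3 (p - w * pd 3 ?f) (vector [x, y, 1]) = 0"
    if "x \<in> cheb_crit (Suc n) ` {1..n}" "y \<in> cheb_crit (Suc n) ` {1..n}" for x y
    using that by (auto simp: ev_def grid_point_def)
  obtain u v where
    "p - w * pd 3 ?f = u * hom_poly 1 n (pderiv (ccheb (Suc n))) + v * hom_poly 2 n (pderiv (ccheb (Suc n)))"
  proof (rule vanishing_on_grid[OF pderiv_ccheb_nonzero _ _ _ homog_comp_minus[OF p wk] grid])
    show "card (cheb_crit (Suc n) ` {1..n}) = degree (pderiv (ccheb (Suc n)))"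
      by (simp only: card_image[OF inj_on_cheb_crit] degree_pderiv_ccheb) simp
    fix u v
    assume "p - w * pd 3 ?f = u * hom_poly 1 (degree (pderiv (ccheb (Suc n)))) (pderiv (ccheb (Suc n))) +
        v * hom_poly 2 (degree (pderiv (ccheb (Suc n)))) (pderiv (ccheb (Suc n)))"
    then show thesis using that[of u v] by simp
  qed (simp_all add: poly_pderiv_ccheb_eq_0_iff)
  then have "p = u * pd 1 ?f + v * pd 2 ?f + w * pd 3 ?f"
    by (simp add: pd_cheb_form(1,2) diff_eq_eq)
  then show ?thesis
    by (simp only: jacobian_ideal_add jacobian_ideal_mult pd_in_jacobian_ideal)
qed

text \<open>The bound k >= 2 n - 1 comes from the injectivity of evaluation; surjectivity restricts
  interpolation on the whole grid to the odd points.\<close>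

lemma milnor_comp_has_dim_cheb_form:
  assumes "k + 1 \<ge> 2 * n"
  shows "milnor_comp_has_dim (cheb_form (Suc n)) k (card (odd_grid n))"
proof (rule milnor_comp_has_dim_evaluation[where pt = "grid_point (Suc n)"])
  show "\<exists>L\<in>homog_comp k. \<forall>t\<in>odd_grid n. eval3 L (grid_point (Suc n) t) = (if t = s then 1 else 0)"
    if "s \<in> odd_grid n" for s
  proof -
    have "s \<in> {1..n} \<times> {1..n}" using that by (auto simp: odd_grid_def)
    moreover have "2 * (n - 1) \<le> k" using assms by simp
    ultimately obtain L where "L \<in> homog_comp k"
      "\<forall>t\<in>{1..n} \<times> {1..n}. eval3 L (grid_point (Suc n) t) = (if t = s then 1 else 0)"
      using interpolation_grid by meson
    moreover have "odd_grid n \<subseteq> {1..n} \<times> {1..n}" by (auto simp: odd_grid_def)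
    ultimately show ?thesis by blast
  qed
qed (use assms eval3_pd_odd_grid vanishing_on_odd_grid in auto)

section \<open>Singular points and nodes in the projective plane\<close>

lemma eval3_scale: "p \<in> homog_comp k \<Longrightarrow> eval3 p (c *s v) = c ^ k * eval3 p v"
  unfolding eval3_def sum_distrib_left
  by (intro sum.cong) (auto simp: homog_comp_def mon_deg_def power_mult_distrib prod.distrib power_sum)

lemma proj_rel_Image: "v \<noteq> 0 \<Longrightarrow> proj_rel `` {v} = {c *s v |c. c \<noteq> 0}"
  by (auto simp: proj_rel_def vector_mul_eq_0)

lemma proj_rel_Image_scale:
  assumes "v \<noteq> 0" "c \<noteq> 0"
  shows "proj_rel `` {c *s v} = proj_rel `` {v}"
proof -
  have "\<exists>b. a *s v = b *s (c *s v) \<and> b \<noteq> 0" if "a \<noteq> 0" for a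
    using that assms(2) by (intro exI[of _ "a / c"]) (simp add: vector_smult_assoc)
  moreover have "\<exists>b. a *s (c *s v) = b *s v \<and> b \<noteq> 0" if "a \<noteq> 0" for a
    using that assms(2) by (intro exI[of _ "a * c"]) (simp add: vector_smult_assoc)
  ultimately show ?thesis
    using assms by (auto simp: proj_rel_Image)
qed

lemma grid_point_nonzero [simp]: "grid_point d s \<noteq> 0"
proof
  assume "grid_point d s = 0"
  then have "grid_point d s $ 3 = 0" by simp
  then show False by simp
qed

lemma homog_comp_cheb_form: "cheb_form d \<in> homog_comp d"
  unfolding cheb_form_eq by (intro homog_comp_add homog_comp_hom_poly)

lemma homog_comp_pd_cheb_form: "pd i (cheb_form (Suc n)) \<in> homog_comp n"
  using exhaust_3[of i] by (auto simp: pd_cheb_form intro!: homog_comp_add homog_comp_hom_poly)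

lemma eval3_cheb_form_affine:
  "eval3 (cheb_form d) (vector [x, y, 1]) = poly (ccheb d) x + poly (ccheb d) y"
  by (simp add: cheb_form_eq eval3_hom_poly_affine)

lemma odd_gridD:
  assumes "s \<in> odd_grid n"
  shows "fst s \<in> {1..n}" "snd s \<in> {1..n}" "odd (fst s + snd s)"
  using assms by (auto simp: odd_grid_def)

lemma poly_ccheb_odd_grid:
  assumes "s \<in> odd_grid n"
  shows "poly (ccheb (Suc n)) (cheb_crit (Suc n) (fst s)) + poly (ccheb (Suc n)) (cheb_crit (Suc n) (snd s)) = 0"
  using odd_gridD[OF assms] minus_one_power_add_eq_0_iff[of "fst s" "snd s"]
  by (simp add: poly_ccheb_crit)

lemma eval3_hom_poly_at_infinity:
  assumes "v $ 3 = 0"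
  shows "eval3 (hom_poly i e P) v = coeff P e * v $ i ^ e"
proof -
  \<comment> \<open>Only j = e survives, where the last factor is 0 ^ 0 = 1.\<close>
  have "(\<Sum>j\<le>e. coeff P j * v $ i ^ j * 0 ^ (e - j)) = (\<Sum>j\<in>{e}. coeff P j * v $ i ^ j * 0 ^ (e - j))"
    by (rule sum.mono_neutral_right) auto
  then show ?thesis by (simp add: eval3_hom_poly assms)
qed

text \<open>On z = 0 the forms f_x and f_y reduce to nonzero multiples of x^n and y^n, which
  excludes points at infinity. After scaling to z = 1, their vanishing puts the point on the grid,
  and f_z = 0 selects the odd points.\<close>

lemma common_zero_pd_cheb_form:
  assumes "v \<noteq> 0" and zero: "\<And>i. eval3 (pd i (cheb_form (Suc n))) v = 0"
  obtains c s where "c \<noteq> 0" "s \<in> odd_grid n" "c *s v = grid_point (Suc n) s"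
proof -
  have lc: "coeff (pderiv (ccheb (Suc n))) n \<noteq> 0"
    using pderiv_ccheb_nonzero[of n] degree_pderiv_ccheb[of "Suc n"]
    by (metis diff_Suc_1 leading_coeff_0_iff)
  have "v $ 3 \<noteq> 0"
  proof
    assume 3: "v $ 3 = 0"
    have "v $ 1 = 0" "v $ 2 = 0"
      using zero[of 1] zero[of 2] lc by (auto simp: pd_cheb_form eval3_hom_poly_at_infinity[OF 3])
    then show False using 3 assms(1) by (simp add: vec_eq_iff forall_3)
  qed
  define w where "w = (1 / v $ 3) *s v"
  have w3: "w $ 3 = 1" using \<open>v $ 3 \<noteq> 0\<close> by (simp add: w_def)
  have wz: "eval3 (pd i (cheb_form (Suc n))) w = 0" for i
    unfolding w_def eval3_scale[OF homog_comp_pd_cheb_form] zero by simp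
  have "poly (pderiv (ccheb (Suc n))) (w $ 1) = 0" "poly (pderiv (ccheb (Suc n))) (w $ 2) = 0"
    using wz[of 1] wz[of 2] by (simp_all add: pd_cheb_form eval3_hom_poly_affine w3)
  then obtain i j where ij: "i \<in> {1..n}" "j \<in> {1..n}" "w $ 1 = cheb_crit (Suc n) i" "w $ 2 = cheb_crit (Suc n) j"
    unfolding poly_pderiv_ccheb_eq_0_iff by blast
  then have w: "w = grid_point (Suc n) (i, j)"
    by (simp add: vec_eq_iff forall_3 w3)
  have "(-1) ^ i + (-1) ^ j = (0::complex)"
    using wz[of 3] eval3_pd_grid_point(3)[of "(i, j)" n] ij by (simp add: w del: of_nat_Suc)
  then have "(i, j) \<in> odd_grid n"
    using ij unfolding minus_one_power_add_eq_0_iff by (simp add: odd_grid_def)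
  with w show thesis
    using \<open>v $ 3 \<noteq> 0\<close> by (intro that[of "1 / v $ 3" "(i, j)"]) (simp_all add: w_def)
qed

lemma sing_locus_cheb_form:
  "sing_locus (cheb_form (Suc n)) = (\<lambda>s. proj_rel `` {grid_point (Suc n) s}) ` odd_grid n"
proof (intro equalityI subsetI)
  fix P assume P: "P \<in> sing_locus (cheb_form (Suc n))"
  then obtain v where v: "v \<noteq> 0" "P = proj_rel `` {v}"
    by (auto simp: sing_locus_def proj_curve_def proj_plane_def quotient_def)
  have "v \<in> P" using v by (auto simp: proj_rel_Image intro: exI[of _ 1])
  then have "eval3 (pd i (cheb_form (Suc n))) v = 0" for i
    using P by (simp add: sing_locus_def)
  then obtain c s where s: "c \<noteq> 0" "s \<in> odd_grid n" "c *s v = grid_point (Suc n) s"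
    by (rule common_zero_pd_cheb_form[OF v(1)])
  have "P = proj_rel `` {grid_point (Suc n) s}"
    using proj_rel_Image_scale[OF v(1) s(1)] v(2) s(3) by simp
  then show "P \<in> (\<lambda>s. proj_rel `` {grid_point (Suc n) s}) ` odd_grid n"
    using s(2) by (rule image_eqI)
next
  fix P assume "P \<in> (\<lambda>s. proj_rel `` {grid_point (Suc n) s}) ` odd_grid n"
  then obtain s where s: "s \<in> odd_grid n" "P = proj_rel `` {grid_point (Suc n) s}" by blast
  have "P \<in> proj_plane" using s(2) by (auto simp: proj_plane_def quotient_def)
  moreover have "eval3 (cheb_form (Suc n)) v = 0 \<and> eval3 (pd i (cheb_form (Suc n))) v = 0" if "v \<in> P" for v i
  proof -
    obtain c where c: "v = c *s grid_point (Suc n) s" using \<open>v \<in> P\<close> s(2) by (auto simp: proj_rel_Image)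
    \<comment> \<open>The point lies on the curve since T takes the values (-1)^i and (-1)^j, which
      are opposite at an odd point.\<close>
    have "eval3 (cheb_form (Suc n)) (grid_point (Suc n) s) = 0"
      using poly_ccheb_odd_grid[OF s(1)] by (simp add: grid_point_def split_beta eval3_cheb_form_affine)
    then show ?thesis
      unfolding c eval3_scale[OF homog_comp_pd_cheb_form] eval3_scale[OF homog_comp_cheb_form]
      using eval3_pd_odd_grid[OF s(1)] by simp
  qed
  ultimately show "P \<in> sing_locus (cheb_form (Suc n))"
    by (simp add: sing_locus_def proj_curve_def)
qed

text \<open>Proportional vectors with last coordinate 1 are equal.\<close>

lemma inj_on_proj_grid_point: "inj_on (\<lambda>s. proj_rel `` {grid_point (Suc n) s}) (odd_grid n)"
proof (rule inj_onI)
  fix s t assume s: "s \<in> odd_grid n" and t: "t \<in> odd_grid n"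
    and "proj_rel `` {grid_point (Suc n) s} = proj_rel `` {grid_point (Suc n) t}"
  moreover have "grid_point (Suc n) s \<in> proj_rel `` {grid_point (Suc n) s}"
    by (auto simp: proj_rel_Image intro: exI[of _ 1])
  ultimately obtain c where c: "grid_point (Suc n) s = c *s grid_point (Suc n) t"
    by (auto simp: proj_rel_Image)
  then have "grid_point (Suc n) s $ 3 = c * grid_point (Suc n) t $ 3" by simp
  then have "c = 1" by simp
  with c have "grid_point (Suc n) s $ 1 = grid_point (Suc n) t $ 1" "grid_point (Suc n) s $ 2 = grid_point (Suc n) t $ 2"
    by simp_all
  then show "s = t"
    using inj_onD[OF inj_on_cheb_crit] odd_gridD[OF s] odd_gridD[OF t] by (simp add: prod_eq_iff)
qed

text \<open>In the chart z = 1 the equation T(x) + T(y) = 0 is separated, with a simple critical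
  point in each variable.\<close>

lemma is_node_cheb_form:
  assumes "s \<in> odd_grid n"
  shows "is_node (cheb_form (Suc n)) (proj_rel `` {grid_point (Suc n) s})"
  unfolding is_node_def
proof (intro bexI exI conjI)
  let ?p = "vector [cheb_crit (Suc n) (fst s), cheb_crit (Suc n) (snd s)] :: complex ^ 2"
  let ?\<kappa> = "\<lambda>w :: complex ^ 2. vector [w $ 1, w $ 2, 1] :: complex ^ 3"
  show "?\<kappa> \<in> affine_charts" by (simp add: affine_charts_def)
  have "?\<kappa> ?p = grid_point (Suc n) s" by (simp add: grid_point_def split_beta)
  then show "?\<kappa> ?p \<in> proj_rel `` {grid_point (Suc n) s}"
    by (auto simp: proj_rel_Image intro: exI[of _ 1])
  show "A1_at (\<lambda>w. eval3 (cheb_form (Suc n)) (?\<kappa> w)) ?p"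
    unfolding eval3_cheb_form_affine
    by (rule A1_at_separated) (use odd_gridD[OF assms] poly_ccheb_odd_grid[OF assms] in
      \<open>simp_all add: poly_pderiv_ccheb_crit poly_pderiv2_ccheb_crit\<close>)
qed

lemma has_nodes_cheb_form: "has_nodes_as_singularities (cheb_form (Suc n)) (card (odd_grid n))"
  unfolding has_nodes_as_singularities_def sing_locus_cheb_form
  using card_image[OF inj_on_proj_grid_point] is_node_cheb_form by auto

section \<open>Counting the odd grid points\<close>

lemma card_odd_even_Icc: "card {i \<in> {1..n}. odd i} = Suc n div 2 \<and> card {i \<in> {1..n}. even i} = n div 2"
proof (induction n)
  case (Suc n)
  have "{i \<in> {1..Suc n}. odd i} = (if even n then insert (Suc n) {i \<in> {1..n}. odd i} else {i \<in> {1..n}. odd i})"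
    "{i \<in> {1..Suc n}. even i} = (if odd n then insert (Suc n) {i \<in> {1..n}. even i} else {i \<in> {1..n}. even i})"
    by (auto simp: le_Suc_eq)
  moreover have "card (insert (Suc n) {i \<in> {1..n}. Q i}) = Suc (card {i \<in> {1..n}. Q i})" for Q
    by (subst card_insert_disjoint) auto
  ultimately show ?case
    using Suc.IH by (simp del: atLeastAtMost_iff)
qed auto

text \<open>An odd index sum means one odd and one even index, which gives two disjoint rectangles
  of equal size.\<close>

lemma card_odd_grid: "card (odd_grid n) = 2 * (Suc n div 2) * (n div 2)"
proof -
  define O' E' where "O' = {i \<in> {1..n}. odd i}" and "E' = {i \<in> {1..n}. even i}"
  have fin: "finite O'" "finite E'" and disj: "O' \<inter> E' = {}"
    by (auto simp: O'_def E'_def)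
  have "odd_grid n = O' \<times> E' \<union> E' \<times> O'"
    by (auto simp: odd_grid_def O'_def E'_def)
  also have "card \<dots> = card (O' \<times> E') + card (E' \<times> O')"
    using fin disj by (intro card_Un_disjoint finite_cartesian_product) blast+
  also have "\<dots> = 2 * card O' * card E'"
    by (simp add: card_cartesian_product)
  finally show ?thesis by (simp only: O'_def E'_def card_odd_even_Icc)
qed

theorem corollary1p2:
  fixes d :: nat
  assumes "d > 0"
  shows "(\<forall>m::nat. d = 2 * m \<longrightarrow>
            has_nodes_as_singularities (cheb_form d) (2 * m * (m - 1)) \<and>
            (\<forall>k::nat. int k \<ge> 2 * int d - 3 \<longrightarrow>
               milnor_comp_has_dim (cheb_form d) k (2 * m * (m - 1)))) \<and>
         (\<forall>m::nat. d = 2 * m + 1 \<longrightarrow>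
            has_nodes_as_singularities (cheb_form d) (2 * m\<^sup>2) \<and>
            (\<forall>k::nat. int k \<ge> 2 * int d - 3 \<longrightarrow>
               milnor_comp_has_dim (cheb_form d) k (2 * m\<^sup>2)))"
proof -
  obtain n where d: "d = Suc n" using assms by (cases d) auto
  \<comment> \<open>With d = n + 1 the bound reads k >= 2 n - 1. Over the integers it also makes
    sense for d = 1, where it is negative.\<close>
  have dim: "milnor_comp_has_dim (cheb_form d) k (card (odd_grid n))" if "int k \<ge> 2 * int d - 3" for k
    unfolding d by (rule milnor_comp_has_dim_cheb_form) (use that d in simp)
  have nodes: "has_nodes_as_singularities (cheb_form d) (card (odd_grid n))"
    unfolding d by (rule has_nodes_cheb_form)
  have even: "card (odd_grid n) = 2 * m * (m - 1)" if "d = 2 * m" for m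
  proof -
    \<comment> \<open>Among the indices from 1 to 2 m - 1 there are m odd and m - 1 even
      ones.\<close>
    have "Suc n div 2 = m" "n div 2 = m - 1" using that d by auto
    then show ?thesis by (simp add: card_odd_grid)
  qed
  have odd: "card (odd_grid n) = 2 * m\<^sup>2" if "d = 2 * m + 1" for m
  proof -
    have "Suc n div 2 = m" "n div 2 = m" using that d by auto
    then show ?thesis by (simp add: card_odd_grid power2_eq_square)
  qed
  show ?thesis
    using dim nodes by (intro conjI allI impI) (simp_all only: even odd)
qed

end
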